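(* Assume that (a) the set $A(x)$ is compact for every $x\in X$; (b) $c:\mathbb K\to\mathbb R$ is lower semicontinuous, nonnegative and inf-compact on $\mathbb K$; (c) $Q$ is strongly Feller; and (d) there exist $\bar c>0$, $\beta\in[1,1/\alpha)$ and a measurable weight function $w:X\setminus K\to[1,\infty)$ such that for every $x\in X\setminus K$ $$\sup_{a\in A(x)}c(x,a)\le\bar c\,w(x)\qquad\text{and}\qquad\sup_{a\in A(x)}\int_{X\setminus K}Q(\mathrm dy\mid x,a)\,w(y)\le\beta\,w(x).$$ Let $\gamma:=\alpha\beta$. Then: (i) The $\alpha$-discount value function satisfies $\|V^\star\|_w\le\bar c/(1-\gamma)$. (ii) The $\alpha$-value iteration functions $(v_n)_{n\ge0}$ satisfy $$V^\star(x)-v_n(x)\le\bar c\,w(x)\,\frac{\gamma^n}{1-\gamma}\qquad\text{for all }x\in X\setminus K\text{ and all }n\in\{1,2,\ldots\}.$$ In particular, $\|v_n-V^\star\|_w\le\bar c\,\gamma^n/(1-\gamma)$ for all $n\in\{0,1,2,\ldots\}$. (iii) $V^\star$ is the unique nonnegative measurable function $\xi$ on $X\setminus K$ with $\|\xi\|_w<\infty$ that solves $$\xi(x)=\min_{a\in A(x)}\left[c(x,a)+\alpha\int_{X\setminus K}Q(\mathrm dy\mid x,a)\,\xi(y)\right]\qquad\text{for all }x\in X\setminus K.$$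
   Context: Control model. $X$ (state space) and $A$ (action set) are nonempty Borel subsets of Polish spaces. For each $x\in X$, $A(x)\subseteq A$ is a nonempty measurable set of feasible actions; the set $\{(x,a): x\in X,\ a\in A(x)\}$ is a measurable subset of $X\times A$ and contains the graph of a measurable function from $X$ to $A$. $Q$ is a stochastic kernel on $X$ given the feasible state-action pairs (the transition law). $K\subseteq X$ is a measurable target set (not assumed absorbing), $\mathbb K:=\{(x,a)\in X\times A: x\in X\setminus K,\ a\in A(x)\}$, and $c:\mathbb K\to\mathbb R$ is a measurable cost-per-stage function. $\alpha\in(0,1)$ is fixed. "Measurable" means Borel-measurable. Policies and process. $\tau:=\inf\{i\ge 0: x_i\in K\}$ (with $\inf\emptyset=+\infty$). The process is controlled only up to $\tau$: a policy $\pi=(\varphi_t)_{t\ge0}$ in the class $\Pi$ (randomized Markov policies) is a sequence of stochastic kernels $\varphi_t$ on $A$ with $\varphi_t(A(x)\mid x)=1$ for $x\in X\setminus K$. Under $\mathsf P^\pi_x$ one has $x_0=x$ and, on $\{t<\tau\}$, conditionally on the history up to time $t$, $a_t\sim\varphi_t(\cdot\mid x_t)$ and then $x_{t+1}\sim Q(\cdot\mid x_t,a_t)$. Costs. $V(\pi,x):=\mathsf E^\pi_x\big[\sum_{i=0}^{\tau-1}\alpha^i c(x_i,a_i)\big]$ and $V^\star(x):=\inf_{\pi\in\Pi}V(\pi,x)$, $x\in X\setminus K$. The $\alpha$-value iteration functions are $v_0:=0$ and, for $n\ge1$ and $x\in X\setminus K$, $v_n(x):=\min_{a\in A(x)}\big[c(x,a)+\alpha\int_{X\setminus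 K}Q(\mathrm dy\mid x,a)\,v_{n-1}(y)\big]$. Norm and regularity notions. $\|u\|_w:=\sup_{x\in X\setminus K}|u(x)|/w(x)$. A function $g:\mathbb K\to\mathbb R$ is lower semicontinuous if $\liminf_j g(x_j,a_j)\ge g(x,a)$ whenever $(x_j,a_j)\to(x,a)$ in $\mathbb K$; it is inf-compact on $\mathbb K$ if for every $x\in X\setminus K$ and $r\in\mathbb R$ the set $\{a\in A(x): g(x,a)\le r\}$ is compact. $Q$ is strongly Feller if for every bounded measurable $g:X\to\mathbb R$ the map $(x,a)\mapsto\int_X g(y)\,Q(\mathrm dy\mid x,a)$ is continuous and bounded on $\mathbb K$. *)

theory Defs
  imports "HOL-Probability.Probability"
begin

section \<open>The control model\<close>

record ('x, 'a) control_model =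
  states :: "'x set"
  actions :: "'a set"
  feasible :: "'x \<Rightarrow> 'a set"
  trans_law :: "'x \<times> 'a \<Rightarrow> 'x measure"
  target :: "'x set"
  cost :: "'x \<times> 'a \<Rightarrow> real"
  discount :: real

definition state_space :: "('x::topological_space, 'a, 'm) control_model_scheme \<Rightarrow> 'x measure" where
  "state_space M = restrict_space borel (states M)"

definition action_space :: "('x, 'a::topological_space, 'm) control_model_scheme \<Rightarrow> 'a measure" where
  "action_space M = restrict_space borel (actions M)"

definition non_target :: "('x, 'a, 'm) control_model_scheme \<Rightarrow> 'x set" where
  "non_target M = states M - target M"

definition feasible_pairs :: "('x, 'a, 'm) control_model_scheme \<Rightarrow> ('x \<times> 'a) set" where
  "feasible_pairs M = {(x, a). x \<in> states M \<and> a \<in> feasible M x}"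

text \<open>The set written \<open>\<bbbK>\<close>, of feasible pairs whose state lies outside the target.\<close>

definition active_pairs :: "('x, 'a, 'm) control_model_scheme \<Rightarrow> ('x \<times> 'a) set" where
  "active_pairs M = {(x, a). x \<in> non_target M \<and> a \<in> feasible M x}"

definition is_control_model ::
  "('x::polish_space, 'a::polish_space, 'm) control_model_scheme \<Rightarrow> bool" where
  "is_control_model M \<longleftrightarrow>
     states M \<noteq> {} \<and> states M \<in> sets borel \<and>
     actions M \<noteq> {} \<and> actions M \<in> sets borel \<and>
     (\<forall>x\<in>states M. feasible M x \<noteq> {} \<and> feasible M x \<subseteq> actions M \<and> feasible M x \<in> sets borel) \<and>
     feasible_pairs M \<in> sets borel \<and>
     (\<exists>f \<in> state_space M \<rightarrow>\<^sub>M action_space M. \<forall>x\<in>states M. (x, f x) \<in> feasible_pairs M) \<and>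
     trans_law M \<in> restrict_space borel (feasible_pairs M) \<rightarrow>\<^sub>M prob_algebra (state_space M) \<and>
     target M \<subseteq> states M \<and> target M \<in> sets borel \<and>
     cost M \<in> borel_measurable (restrict_space borel (active_pairs M)) \<and>
     0 < discount M \<and> discount M < 1"


section \<open>Policies and the controlled process\<close>

definition policies ::
  "('x::topological_space, 'a::topological_space, 'm) control_model_scheme \<Rightarrow> (nat \<Rightarrow> 'x \<Rightarrow> 'a measure) set" where
  "policies M = {\<phi>. \<forall>t.
     \<phi> t \<in> state_space M \<rightarrow>\<^sub>M prob_algebra (action_space M) \<and>
     (\<forall>x\<in>non_target M. emeasure (\<phi> t x) (feasible M x) = 1)}"

text \<open>The process is controlled only up to the hitting time of the target. To have a measure on
  infinite trajectories, the state component is frozen from that time on (and after an infeasible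
  action, which has probability 0); no cost is incurred from then on, so this choice does not
  affect the expected cost.\<close>

definition next_state ::
  "('x::topological_space, 'a, 'm) control_model_scheme \<Rightarrow> 'x \<times> 'a \<Rightarrow> 'x measure" where
  "next_state M p = (if p \<in> active_pairs M then trans_law M p else return (state_space M) (fst p))"

text \<open>Trajectories are sequences \<open>\<omega>\<close> of state-action pairs \<open>\<omega> t = (x\<^sub>t, a\<^sub>t)\<close>. The following is the
  conditional law of \<open>\<omega> t\<close> given \<open>\<omega> 0, \<dots>, \<omega> (t - 1)\<close>, for the initial state \<open>x\<close>.\<close>

definition step_kernel ::
  "('x::topological_space, 'a::topological_space, 'm) control_model_scheme \<Rightarrow> (nat \<Rightarrow> 'x \<Rightarrow> 'a measure)
     \<Rightarrow> 'x \<Rightarrow> nat \<Rightarrow> (nat \<Rightarrow> 'x \<times> 'a) \<Rightarrow> ('x \<times> 'a) measure" where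
  "step_kernel M \<phi> x t \<omega> =
     (if t = 0 then return (state_space M) x else next_state M (\<omega> (t - 1))) \<bind>
       (\<lambda>y. \<phi> t y \<bind> (\<lambda>a. return (state_space M \<Otimes>\<^sub>M action_space M) (y, a)))"

text \<open>The law \<open>P\<^sup>\<pi>\<^sub>x\<close> of the trajectory, given by the Ionescu-Tulcea theorem.\<close>

definition path_measure ::
  "('x::topological_space, 'a::topological_space, 'm) control_model_scheme \<Rightarrow> (nat \<Rightarrow> 'x \<Rightarrow> 'a measure)
     \<Rightarrow> 'x \<Rightarrow> (nat \<Rightarrow> 'x \<times> 'a) measure" where
  "path_measure M \<phi> x =
     projective_family.lim UNIV
       (Ionescu_Tulcea.CI (step_kernel M \<phi> x) (\<lambda>_. state_space M \<Otimes>\<^sub>M action_space M))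
       (\<lambda>_. state_space M \<Otimes>\<^sub>M action_space M)"

lemma Ionescu_Tulcea_step_kernel:
  fixes M :: "('x::polish_space, 'a::polish_space, 'm) control_model_scheme"
  assumes "is_control_model M" "\<phi> \<in> policies M" "x \<in> states M"
  shows "Ionescu_Tulcea (step_kernel M \<phi> x) (\<lambda>_. state_space M \<Otimes>\<^sub>M action_space M)"
proof -
  let ?X = "state_space M" and ?A = "action_space M"
  have sp: "space ?X = states M"
    by (simp add: state_space_def space_restrict_space)
  have \<phi>[measurable]: "\<phi> t \<in> ?X \<rightarrow>\<^sub>M prob_algebra ?A" for t
    using assms(2) by (auto simp: policies_def)
  have X: "states M \<in> sets borel" "actions M \<in> sets borel" "target M \<in> sets borel"
      "feasible_pairs M \<in> sets borel"
    and Q: "trans_law M \<in> restrict_space borel (feasible_pairs M) \<rightarrow>\<^sub>M prob_algebra ?X"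
    and sub: "\<And>x. x \<in> states M \<Longrightarrow> feasible M x \<subseteq> actions M"
    using assms(1) by (auto simp: is_control_model_def)
  have idX: "(\<lambda>y. y) \<in> ?X \<rightarrow>\<^sub>M borel" and idA: "(\<lambda>a. a) \<in> ?A \<rightarrow>\<^sub>M borel"
    by (simp_all add: state_space_def action_space_def measurable_restrict_space1)
  have idXA: "(\<lambda>p. p) \<in> ?X \<Otimes>\<^sub>M ?A \<rightarrow>\<^sub>M borel"
    unfolding borel_prod[symmetric] measurable_pair_iff comp_def
    using measurable_compose[OF measurable_fst idX] measurable_compose[OF measurable_snd idA] by auto
  have eq: "active_pairs M = feasible_pairs M - target M \<times> UNIV"
    by (auto simp: active_pairs_def feasible_pairs_def non_target_def)
  have "target M \<times> (UNIV :: 'a set) \<in> sets borel"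
    using X(3) by (simp add: borel_prod[symmetric])
  then have act: "active_pairs M \<in> sets borel"
    using X by (simp add: eq)
  have act': "active_pairs M \<in> sets (?X \<Otimes>\<^sub>M ?A)"
  proof -
    have "active_pairs M \<subseteq> space (?X \<Otimes>\<^sub>M ?A)"
      using sub by (auto simp: space_pair_measure state_space_def action_space_def
          space_restrict_space active_pairs_def non_target_def)
    then show ?thesis
      using measurable_sets[OF idXA act] by (simp add: Int_absorb2)
  qed
  have Q': "trans_law M \<in> restrict_space (?X \<Otimes>\<^sub>M ?A) (active_pairs M) \<rightarrow>\<^sub>M prob_algebra ?X"
    by (rule measurable_compose[OF _ Q], rule measurable_restrict_space2)
       (auto simp: space_restrict_space eq intro!: measurable_restrict_space1 idXA)
  have nxt[measurable]: "next_state M \<in> ?X \<Otimes>\<^sub>M ?A \<rightarrow>\<^sub>M prob_algebra ?X"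
    unfolding next_state_def using act'
    by (intro measurable_If_restrict_space_iff[THEN iffD2])
       (auto intro!: Q' measurable_restrict_space1 measurable_compose[OF measurable_fst measurable_return_prob_space])
  have step[measurable]: "step_kernel M \<phi> x t \<in> PiM {0..<t} (\<lambda>_. ?X \<Otimes>\<^sub>M ?A) \<rightarrow>\<^sub>M prob_algebra (?X \<Otimes>\<^sub>M ?A)" for t
  proof -
    have "(\<lambda>\<omega>. if t = 0 then return ?X x else next_state M (\<omega> (t - 1)))
        \<in> PiM {0..<t} (\<lambda>_. ?X \<Otimes>\<^sub>M ?A) \<rightarrow>\<^sub>M prob_algebra ?X"
      using assms(3)
      by (cases "t = 0")
         (auto simp: sp space_prob_algebra prob_space_return intro!: measurable_compose[OF _ nxt])
    then show ?thesis
      unfolding step_kernel_def by measurable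
  qed
  have "prob_space (step_kernel M \<phi> x t \<omega>)" if "\<omega> \<in> space (PiM {0..<t} (\<lambda>_. ?X \<Otimes>\<^sub>M ?A))" for t \<omega>
    using measurable_space[OF step that] by (simp add: space_prob_algebra)
  with measurable_prob_algebraD[OF step] show ?thesis
    by (rule Ionescu_Tulcea.intro)
qed

definition hitting_time ::
  "('x, 'a, 'm) control_model_scheme \<Rightarrow> (nat \<Rightarrow> 'x \<times> 'a) \<Rightarrow> enat" where
  "hitting_time M \<omega> = (INF i\<in>{i. fst (\<omega> i) \<in> target M}. enat i)"


section \<open>Costs and value iteration\<close>

text \<open>The Lebesgue integral of an extended-real function. The library's Bochner integral is
  not suitable here because it is 0 for non-integrable functions.\<close>

definition ext_integral :: "'b measure \<Rightarrow> ('b \<Rightarrow> ereal) \<Rightarrow> ereal" where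
  "ext_integral N f = enn2ereal (\<integral>\<^sup>+ y. e2ennreal (f y) \<partial>N) - enn2ereal (\<integral>\<^sup>+ y. e2ennreal (- f y) \<partial>N)"

definition total_cost :: "('x, 'a, 'm) control_model_scheme \<Rightarrow> (nat \<Rightarrow> 'x \<times> 'a) \<Rightarrow> ereal" where
  "total_cost M \<omega> = (\<Sum>i. if enat i < hitting_time M \<omega> then ereal (discount M ^ i * cost M (\<omega> i)) else 0)"

definition expected_cost ::
  "('x::topological_space, 'a::topological_space, 'm) control_model_scheme \<Rightarrow> (nat \<Rightarrow> 'x \<Rightarrow> 'a measure)
     \<Rightarrow> 'x \<Rightarrow> ereal" where
  "expected_cost M \<phi> x = ext_integral (path_measure M \<phi> x) (total_cost M)"

definition value_function ::
  "('x::topological_space, 'a::topological_space, 'm) control_model_scheme \<Rightarrow> 'x \<Rightarrow> ereal" where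
  "value_function M x = (INF \<phi>\<in>policies M. expected_cost M \<phi> x)"

text \<open>\<open>\<integral>\<^bsub>X \<setminus> K\<^esub> Q(dy | p) u(y)\<close>; only the values of \<open>u\<close> on \<open>X \<setminus> K\<close> matter.\<close>

definition trans_integral ::
  "('x, 'a, 'm) control_model_scheme \<Rightarrow> ('x \<Rightarrow> ereal) \<Rightarrow> 'x \<times> 'a \<Rightarrow> ereal" where
  "trans_integral M u p = ext_integral (trans_law M p) (\<lambda>y. if y \<in> non_target M then u y else 0)"

definition bellman ::
  "('x, 'a, 'm) control_model_scheme \<Rightarrow> ('x \<Rightarrow> ereal) \<Rightarrow> 'x \<Rightarrow> 'a \<Rightarrow> ereal" where
  "bellman M u x a = ereal (cost M (x, a)) + ereal (discount M) * trans_integral M u (x, a)"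

text \<open>\<open>m = min\<^bsub>s \<in> S\<^esub> f s\<close>, including that the minimum is attained.\<close>

definition is_minimum :: "'b set \<Rightarrow> ('b \<Rightarrow> ereal) \<Rightarrow> ereal \<Rightarrow> bool" where
  "is_minimum S f m \<longleftrightarrow> (\<exists>s\<in>S. f s = m) \<and> (\<forall>s\<in>S. m \<le> f s)"

text \<open>Since functions are total, the recursion takes an infimum; that it is a minimum has to be
  stated separately.\<close>

primrec value_iter :: "('x, 'a, 'm) control_model_scheme \<Rightarrow> nat \<Rightarrow> 'x \<Rightarrow> ereal" where
  "value_iter M 0 = (\<lambda>x. 0)"
| "value_iter M (Suc n) = (\<lambda>x. INF a\<in>feasible M x. bellman M (value_iter M n) x a)"


section \<open>Norm and regularity notions\<close>

definition weighted_norm ::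
  "('x, 'a, 'm) control_model_scheme \<Rightarrow> ('x \<Rightarrow> real) \<Rightarrow> ('x \<Rightarrow> ereal) \<Rightarrow> ereal" where
  "weighted_norm M w u = (SUP x\<in>non_target M. \<bar>u x\<bar> / ereal (w x))"

definition seq_lsc_on :: "'b::topological_space set \<Rightarrow> ('b \<Rightarrow> real) \<Rightarrow> bool" where
  "seq_lsc_on S g \<longleftrightarrow>
     (\<forall>p q. (\<forall>j. p j \<in> S) \<and> q \<in> S \<and> p \<longlonglongrightarrow> q \<longrightarrow> ereal (g q) \<le> liminf (\<lambda>j. ereal (g (p j))))"

definition inf_compact ::
  "('x, 'a::topological_space, 'm) control_model_scheme \<Rightarrow> ('x \<times> 'a \<Rightarrow> real) \<Rightarrow> bool" where
  "inf_compact M g \<longleftrightarrow> (\<forall>x\<in>non_target M. \<forall>r. compact {a \<in> feasible M x. g (x, a) \<le> r})"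

definition strongly_Feller ::
  "('x::topological_space, 'a::topological_space, 'm) control_model_scheme \<Rightarrow> bool" where
  "strongly_Feller M \<longleftrightarrow>
     (\<forall>g :: 'x \<Rightarrow> real. g \<in> borel_measurable (state_space M) \<and> bounded (g ` states M) \<longrightarrow>
        continuous_on (active_pairs M) (\<lambda>p. \<integral>y. g y \<partial>trans_law M p) \<and>
        bounded ((\<lambda>p. \<integral>y. g y \<partial>trans_law M p) ` active_pairs M))"

text \<open>Nonnegative measurable functions on \<open>X \<setminus> K\<close> with finite weighted norm that solve the
  optimality equation. Values are extended reals, but a finite norm forces them to be real.\<close>

definition solves_optimality_eq ::
  "('x::topological_space, 'a, 'm) control_model_scheme \<Rightarrow> ('x \<Rightarrow> real) \<Rightarrow> ('x \<Rightarrow> ereal) \<Rightarrow> bool" where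
  "solves_optimality_eq M w \<xi> \<longleftrightarrow>
     (\<forall>x\<in>non_target M. 0 \<le> \<xi> x) \<and>
     \<xi> \<in> borel_measurable (restrict_space borel (non_target M)) \<and>
     weighted_norm M w \<xi> < \<infinity> \<and>
     (\<forall>x\<in>non_target M. is_minimum (feasible M x) (bellman M \<xi> x) (\<xi> x))"

end

theory Submission
  imports Defs
begin

text \<open>
  The theorem is a contraction argument around the optimality operator
  \<open>T u (x) = min\<^bsub>a \<in> A(x)\<^esub> [c(x, a) + \<alpha> \<integral> u dQ(\<cdot> | x, a)]\<close>, with the integral over the states outside
  the target. The growth conditions say that \<open>u \<le> u' + k w\<close> implies \<open>T u \<le> T u' + \<gamma> k w\<close> (\<open>bellman_op_shift\<close>), and that
  \<open>T 0 \<le> c\<^sub>0 w\<close> with \<open>c\<^sub>0\<close> the constant in the bound on the cost. Hence the functions \<open>v\<^sub>n\<close> have a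
  supremum \<open>v\<^sub>\<infinity>\<close> with \<open>v\<^sub>\<infinity> \<le> v\<^sub>n + c\<^sub>0 \<gamma>\<^sup>n w / (1 - \<gamma>)\<close> (\<open>viter_limit_le\<close>), which is a fixed point of \<open>T\<close>
  (\<open>viter_limit_fixed_point\<close>) and the only nonnegative measurable one with finite weighted norm
  (\<open>fixed_point_unique\<close>). It remains to identify \<open>v\<^sub>\<infinity>\<close> with the value function. Iterating \<open>v\<^bsub>n+1\<^esub>(x) \<le> c(x, a) + \<alpha> \<integral> v\<^sub>n dQ\<close> along the process
  shows that no policy costs less than any \<open>v\<^sub>n\<close> (\<open>viter_limit_le_cost\<close>). Iterating the fixed point
  equation along the stationary policy that takes a minimising action in each state shows that this
  policy costs at most \<open>v\<^sub>\<infinity>\<close> (\<open>optimal_policy\<close>).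

  What this needs from topology is that \<open>T\<close> preserves Borel measurability and that minimisers can be
  chosen measurably. The strong Feller property and the lower semicontinuity of \<open>c\<close> make
  \<open>a \<mapsto> c(x, a) + \<alpha> \<integral> u dQ\<close> lower semicontinuous on the compact set \<open>A(x)\<close> for every measurable \<open>u \<ge> 0\<close>, so
  that its sublevel sets are compact and its minimum is attained. But \<open>A(x)\<close> depends on \<open>x\<close> only in a Borel
  way, and measurability of the minimum amounts to the theorem that the projection of a Borel set with
  compact sections is Borel (\<open>borel_projection_of_compact_sections\<close>), together with the corresponding
  selection theorem (\<open>borel_selector_of_compact_sections\<close>). Both are derived here from Novikov's
  separation theorem for sequences of analytic sets (\<open>novikov_separation\<close>).

  The process enters only through the expectations of functions of \<open>(x\<^sub>n, a\<^sub>n)\<close> on the event \<open>n < \<tau>\<close>. These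
  satisfy a recursion in \<open>n\<close> (\<open>stage_mean_0\<close>, \<open>stage_mean_Suc\<close>), and the expected cost is their discounted sum
  (\<open>expected_cost_eq\<close>).
\<close>

section \<open>Analytic sets and separation\<close>

lemma open_seq_contains_cylinder:
  fixes U :: "(nat \<Rightarrow> nat) set"
  assumes "open U" "\<alpha> \<in> U"
  shows "\<exists>k. \<forall>\<beta>. (\<forall>i<k. \<beta> i = \<alpha> i) \<longrightarrow> \<beta> \<in> U"
proof -
  have "openin (product_topology (\<lambda>_. euclidean) UNIV) U"
    using assms(1) by (simp add: open_fun_def)
  from product_topology_open_contains_basis[OF this assms(2)] obtain X where
    X: "\<alpha> \<in> PiE UNIV X" "finite {i. X i \<noteq> (UNIV :: nat set)}" "PiE UNIV X \<subseteq> U"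
    by auto
  obtain k where k: "{i. X i \<noteq> UNIV} \<subseteq> {..<k}"
    using X(2) finite_nat_iff_bounded by auto
  have "\<beta> \<in> U" if "\<And>i. i < k \<Longrightarrow> \<beta> i = \<alpha> i" for \<beta>
  proof -
    have "\<beta> i \<in> X i" for i
    proof (cases "i < k")
      case True
      then show ?thesis using that[OF True] X(1) by (auto simp: PiE_iff)
    next
      case False
      then have "X i = UNIV" using k by auto
      then show ?thesis by simp
    qed
    then show ?thesis using X(3) by (auto simp: PiE_iff)
  qed
  then show ?thesis by blast
qed

lemma open_cylinder: "open {\<beta> :: nat \<Rightarrow> nat. \<forall>i<k. \<beta> i = \<alpha> i}"
proof -
  have "{\<beta> :: nat \<Rightarrow> nat. \<forall>i<k. \<beta> i = \<alpha> i} = (\<Inter>i<k. (\<lambda>\<beta>. \<beta> i) -` {\<alpha> i})"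
    by auto
  also have "open \<dots>"
    by (intro open_INT ballI finite_lessThan open_vimage)
       (auto simp: discrete_topology_class.open_discrete continuous_on_product_coordinates)
  finally show ?thesis .
qed

text \<open>Continuous images of closed subsets of the Baire space \<open>nat \<Rightarrow> nat\<close>. Allowing a closed subset,
  instead of the whole Baire space, includes the empty set and makes closure under intersections easy.\<close>

definition analytic :: "'x::topological_space set \<Rightarrow> bool" where
  "analytic A \<longleftrightarrow> (\<exists>(C :: (nat \<Rightarrow> nat) set) f. closed C \<and> continuous_on C f \<and> A = f ` C)"

lemma analyticE:
  assumes "analytic A"
  obtains C :: "(nat \<Rightarrow> nat) set" and f where "closed C" "continuous_on C f" "A = f ` C"
  using assms unfolding analytic_def by blast

lemma analytic_continuous_image:
  assumes "analytic A" "continuous_on A g"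
  shows "analytic (g ` A)"
proof -
  obtain C :: "(nat \<Rightarrow> nat) set" and f where C: "closed C" "continuous_on C f" "A = f ` C"
    using assms(1) by (rule analyticE)
  have "continuous_on C (g \<circ> f)"
    using C assms(2) by (intro continuous_on_compose) auto
  then show ?thesis
    unfolding analytic_def using C by (intro exI[of _ C] exI[of _ "g \<circ> f"]) auto
qed

lemma analytic_Int_closed:
  fixes A :: "'x::topological_space set"
  assumes "analytic A" "closed F"
  shows "analytic (A \<inter> F)"
proof -
  obtain C :: "(nat \<Rightarrow> nat) set" and f where C: "closed C" "continuous_on C f" "A = f ` C"
    using assms(1) by (rule analyticE)
  have "closed (C \<inter> f -` F)"
    using C(1,2) assms(2) by (metis continuous_closed_preimage Int_commute vimage_def)
  moreover have "continuous_on (C \<inter> f -` F) f"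
    using C(2) by (rule continuous_on_subset) auto
  ultimately show ?thesis
    unfolding analytic_def using C(3) by (intro exI[of _ "C \<inter> f -` F"] exI[of _ f]) auto
qed

lemma analytic_UN:
  fixes A :: "nat \<Rightarrow> 'x::topological_space set"
  assumes "\<And>n. analytic (A n)"
  shows "analytic (\<Union>n. A n)"
proof -
  have "\<forall>n. \<exists>(C :: (nat \<Rightarrow> nat) set) f. closed C \<and> continuous_on C f \<and> A n = f ` C"
    using assms unfolding analytic_def by blast
  then obtain C :: "nat \<Rightarrow> (nat \<Rightarrow> nat) set" and f where
    C: "\<And>n. closed (C n)" "\<And>n. continuous_on (C n) (f n)" "\<And>n. A n = f n ` C n"
    by metis
  define shift :: "(nat \<Rightarrow> nat) \<Rightarrow> nat \<Rightarrow> nat" where "shift \<alpha> = (\<lambda>i. \<alpha> (Suc i))" for \<alpha>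
  have shift: "continuous_on S shift" for S
    unfolding shift_def
    by (intro continuous_on_coordinatewise_then_product)
       (rule continuous_on_subset[OF continuous_on_product_coordinates], simp)
  define D where "D = {\<alpha>. shift \<alpha> \<in> C (\<alpha> 0)}"
  define g where "g \<alpha> = f (\<alpha> 0) (shift \<alpha>)" for \<alpha>
  have o: "open ((\<lambda>\<alpha> :: nat \<Rightarrow> nat. \<alpha> 0) -` {j})" for j
    by (intro open_vimage) (auto simp: discrete_topology_class.open_discrete continuous_on_product_coordinates)
  have "- D = (\<Union>j. ((\<lambda>\<alpha>. \<alpha> 0) -` {j}) \<inter> shift -` (- C j))"
    by (auto simp: D_def)
  moreover have "open \<dots>"
    by (intro open_UN ballI open_Int o open_vimage shift open_Compl C)
  ultimately have D: "closed D"
    by (simp add: closed_def)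
  have g: "continuous_on D g"
    unfolding continuous_on_def
  proof (intro ballI)
    fix \<alpha> assume \<alpha>: "\<alpha> \<in> D"
    let ?U = "(\<lambda>\<alpha> :: nat \<Rightarrow> nat. \<alpha> 0) -` {\<alpha> 0}"
    have "continuous_on (?U \<inter> D) (f (\<alpha> 0) \<circ> shift)"
      by (intro continuous_on_compose shift continuous_on_subset[OF C(2)[of "\<alpha> 0"]])
         (auto simp: D_def)
    moreover have "continuous_on (?U \<inter> D) g \<longleftrightarrow> continuous_on (?U \<inter> D) (f (\<alpha> 0) \<circ> shift)"
      by (rule continuous_on_cong) (auto simp: g_def)
    ultimately have "continuous_on (?U \<inter> D) g" by simp
    then have "(g \<longlongrightarrow> g \<alpha>) (at \<alpha> within (?U \<inter> D))"
      using \<alpha> by (auto simp: continuous_on_def)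
    moreover have "at \<alpha> within (?U \<inter> D) = at \<alpha> within D"
      by (rule at_within_nhd[of _ ?U]) (use o in auto)
    ultimately show "(g \<longlongrightarrow> g \<alpha>) (at \<alpha> within D)"
      by simp
  qed
  have "(\<Union>n. A n) = g ` D"
  proof safe
    fix n x assume "x \<in> A n"
    then obtain \<alpha> where "\<alpha> \<in> C n" "x = f n \<alpha>" using C by auto
    moreover define \<beta> where "\<beta> = (\<lambda>i. case i of 0 \<Rightarrow> n | Suc j \<Rightarrow> \<alpha> j)"
    moreover have "shift \<beta> = \<alpha>" "\<beta> 0 = n"
      by (auto simp: shift_def \<beta>_def)
    ultimately show "x \<in> g ` D"
      by (intro image_eqI[of _ _ \<beta>]) (auto simp: g_def D_def)
  next
    fix \<alpha> assume "\<alpha> \<in> D"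
    then show "g \<alpha> \<in> (\<Union>n. A n)"
      by (auto simp: g_def D_def C)
  qed
  then show ?thesis
    unfolding analytic_def using D g by blast
qed

text \<open>A point of the intersection is coded by one code \<open>row n \<alpha>\<close> for each \<open>A n\<close>, all with the same image;
  agreement of the images is a closed condition.\<close>
lemma analytic_INT:
  fixes A :: "nat \<Rightarrow> 'x::metric_space set"
  assumes "\<And>n. analytic (A n)"
  shows "analytic (\<Inter>n. A n)"
proof -
  have "\<forall>n. \<exists>(C :: (nat \<Rightarrow> nat) set) f. closed C \<and> continuous_on C f \<and> A n = f ` C"
    using assms unfolding analytic_def by blast
  then obtain C :: "nat \<Rightarrow> (nat \<Rightarrow> nat) set" and f where
    C: "\<And>n. closed (C n)" "\<And>n. continuous_on (C n) (f n)" "\<And>n. A n = f n ` C n"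
    by metis
  define row :: "nat \<Rightarrow> (nat \<Rightarrow> nat) \<Rightarrow> nat \<Rightarrow> nat" where
    "row n \<alpha> = (\<lambda>i. \<alpha> (prod_encode (n, i)))" for n \<alpha>
  have row: "continuous_on S (row n)" for S n
    unfolding row_def
    by (intro continuous_on_coordinatewise_then_product)
       (rule continuous_on_subset[OF continuous_on_product_coordinates], simp)
  define E where "E = (\<Inter>n. row n -` C n)"
  have E: "closed E"
    unfolding E_def by (intro closed_INT ballI closed_vimage C row)
  have fr: "continuous_on E (\<lambda>\<alpha>. f n (row n \<alpha>))" for n
    by (rule continuous_on_compose2[OF C(2)[of n] row]) (auto simp: E_def)
  define D where "D = (\<Inter>n. {\<alpha> \<in> E. dist (f n (row n \<alpha>)) (f 0 (row 0 \<alpha>)) \<le> 0})"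
  have "closed D"
    unfolding D_def
    by (intro closed_INT ballI continuous_on_closed_Collect_le continuous_intros fr E)
  moreover have "continuous_on D (\<lambda>\<alpha>. f 0 (row 0 \<alpha>))"
    by (rule continuous_on_subset[OF fr]) (auto simp: D_def)
  moreover have "(\<Inter>n. A n) = (\<lambda>\<alpha>. f 0 (row 0 \<alpha>)) ` D"
  proof safe
    fix x assume "x \<in> (\<Inter>n. A n)"
    then have "\<forall>n. \<exists>\<alpha>. \<alpha> \<in> C n \<and> x = f n \<alpha>" using C(3) by auto
    then obtain \<alpha> where \<alpha>: "\<And>n. \<alpha> n \<in> C n" "\<And>n. x = f n (\<alpha> n)" by metis
    define \<beta> where "\<beta> i = (case prod_decode i of (n, j) \<Rightarrow> \<alpha> n j)" for i
    have "row n \<beta> = \<alpha> n" for n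
      by (auto simp: row_def \<beta>_def)
    then show "x \<in> (\<lambda>\<alpha>. f 0 (row 0 \<alpha>)) ` D"
      using \<alpha> by (intro image_eqI[of _ _ \<beta>]) (auto simp: D_def E_def \<alpha>(2)[symmetric])
  next
    fix \<alpha> n assume "\<alpha> \<in> D"
    then have "f n (row n \<alpha>) = f 0 (row 0 \<alpha>)" "row n \<alpha> \<in> C n"
      by (auto simp: D_def E_def)
    then show "f 0 (row 0 \<alpha>) \<in> A n"
      by (metis C(3) image_eqI)
  qed
  ultimately show ?thesis
    unfolding analytic_def by blast
qed

lemma dense_sequence:
  "\<exists>d :: nat \<Rightarrow> 'x::{metric_space, second_countable_topology}. \<forall>x e. 0 < e \<longrightarrow> (\<exists>n. dist (d n) x < e)"
proof -
  obtain D :: "'x set" where D: "countable D" "\<And>X. open X \<Longrightarrow> X \<noteq> {} \<Longrightarrow> \<exists>d\<in>D. d \<in> X"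
    using countable_dense_setE by blast
  have ne: "D \<noteq> {}" using D(2)[of UNIV] by auto
  have "\<exists>n. dist (from_nat_into D n) x < e" if e: "0 < e" for x e
  proof -
    obtain y where "y \<in> D" "y \<in> ball x e"
      using D(2)[of "ball x e"] e by (metis centre_in_ball empty_iff open_ball)
    moreover obtain n where "from_nat_into D n = y"
      using from_nat_into_surj[OF D(1) \<open>y \<in> D\<close>] by auto
    ultimately show ?thesis by (auto simp: dist_commute)
  qed
  then show ?thesis by blast
qed

text \<open>A point of a Polish space is coded by a sequence of indices of a dense sequence \<open>d\<close> along which \<open>d\<close>
  converges to it at a geometric rate; the limit is then a continuous function of the code.\<close>

lemma analytic_UNIV: "analytic (UNIV :: 'x::{complete_space, second_countable_topology} set)"
proof -
  obtain d :: "nat \<Rightarrow> 'x" where d: "\<And>x e. 0 < e \<Longrightarrow> \<exists>n. dist (d n) x < e"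
    using dense_sequence by blast
  define C :: "(nat \<Rightarrow> nat) set" where
    "C = (\<Inter>n. \<Inter>m\<in>{n..}. {\<alpha>. dist (d (\<alpha> n)) (d (\<alpha> m)) \<le> 2 * (1/2)^n})"
  have C_iff: "\<alpha> \<in> C \<longleftrightarrow> (\<forall>n m. n \<le> m \<longrightarrow> dist (d (\<alpha> n)) (d (\<alpha> m)) \<le> 2 * (1/2)^n)" for \<alpha>
    by (auto simp: C_def)
  have d_cont: "continuous_on UNIV (\<lambda>\<alpha> :: nat \<Rightarrow> nat. d (\<alpha> n))" for n
    by (rule continuous_on_compose2[of UNIV d, OF _ continuous_on_product_coordinates])
       (auto simp: continuous_on_def at_discrete)
  have "closed C"
    unfolding C_def
    by (intro closed_INT ballI closed_Collect_le continuous_on_dist d_cont continuous_on_const)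
  have conv: "(\<lambda>n. d (\<alpha> n)) \<longlonglongrightarrow> lim (\<lambda>n. d (\<alpha> n))" if "\<alpha> \<in> C" for \<alpha>
  proof -
    have "Cauchy (\<lambda>n. d (\<alpha> n))"
      unfolding Cauchy_altdef2
    proof (intro allI impI)
      fix e :: real assume "0 < e"
      then obtain N where N: "(1/2)^N < e/2"
        using real_arch_pow_inv[of "e/2" "1/2"] by auto
      show "\<exists>N. \<forall>n\<ge>N. dist (d (\<alpha> n)) (d (\<alpha> N)) < e"
      proof (intro exI[of _ N] allI impI)
        fix n assume "N \<le> n"
        then have "dist (d (\<alpha> N)) (d (\<alpha> n)) \<le> 2 * (1/2)^N"
          using that by (auto simp: C_iff)
        with N show "dist (d (\<alpha> n)) (d (\<alpha> N)) < e"
          by (simp add: dist_commute)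
      qed
    qed
    then show ?thesis
      by (simp add: Cauchy_convergent_iff convergent_LIMSEQ_iff)
  qed
  have close: "dist (d (\<alpha> n)) (lim (\<lambda>n. d (\<alpha> n))) \<le> 2 * (1/2)^n" if "\<alpha> \<in> C" for \<alpha> n
  proof (rule LIMSEQ_le_const2)
    show "(\<lambda>m. dist (d (\<alpha> n)) (d (\<alpha> m))) \<longlonglongrightarrow> dist (d (\<alpha> n)) (lim (\<lambda>n. d (\<alpha> n)))"
      by (intro tendsto_dist tendsto_const conv that)
    show "\<exists>N. \<forall>m\<ge>N. dist (d (\<alpha> n)) (d (\<alpha> m)) \<le> 2 * (1/2)^n"
      using that by (auto simp: C_iff intro!: exI[of _ n])
  qed
  have cont: "continuous_on C (\<lambda>\<alpha>. lim (\<lambda>n. d (\<alpha> n)))"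
    unfolding continuous_on_def
  proof (intro ballI)
    fix \<alpha> assume \<alpha>: "\<alpha> \<in> C"
    show "((\<lambda>\<alpha>. lim (\<lambda>n. d (\<alpha> n))) \<longlongrightarrow> lim (\<lambda>n. d (\<alpha> n))) (at \<alpha> within C)"
    proof (rule tendstoI)
      fix e :: real assume "0 < e"
      then obtain N where N: "(1/2)^N < e/4"
        using real_arch_pow_inv[of "e/4" "1/2"] by auto
      let ?U = "{\<beta>. \<forall>i<Suc N. \<beta> i = \<alpha> i}"
      have "dist (lim (\<lambda>n. d (\<beta> n))) (lim (\<lambda>n. d (\<alpha> n))) < e" if "\<beta> \<in> ?U" "\<beta> \<in> C" for \<beta>
      proof -
        have "dist (lim (\<lambda>n. d (\<beta> n))) (lim (\<lambda>n. d (\<alpha> n)))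
            \<le> dist (d (\<beta> N)) (lim (\<lambda>n. d (\<beta> n))) + dist (d (\<alpha> N)) (lim (\<lambda>n. d (\<alpha> n)))"
          using that(1) by (simp add: dist_triangle3)
        also have "\<dots> \<le> 2 * (1/2)^N + 2 * (1/2)^N"
          by (intro add_mono close that \<alpha>)
        finally show ?thesis using N by simp
      qed
      then show "\<forall>\<^sub>F \<beta> in at \<alpha> within C. dist (lim (\<lambda>n. d (\<beta> n))) (lim (\<lambda>n. d (\<alpha> n))) < e"
        unfolding eventually_at_topological
        by (intro exI[of _ ?U] conjI open_cylinder) auto
    qed
  qed
  have "x \<in> (\<lambda>\<alpha>. lim (\<lambda>n. d (\<alpha> n))) ` C" for x
  proof -
    have "\<forall>n. \<exists>k. dist (d k) x < (1/2)^n"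
      using d by auto
    then obtain \<alpha> where \<alpha>: "\<And>n. dist (d (\<alpha> n)) x < (1/2)^n" by metis
    have "\<alpha> \<in> C"
      unfolding C_iff
    proof (intro allI impI)
      fix n m :: nat assume "n \<le> m"
      have "dist (d (\<alpha> n)) (d (\<alpha> m)) \<le> dist (d (\<alpha> n)) x + dist (d (\<alpha> m)) x"
        by (rule dist_triangle2)
      also have "\<dots> \<le> (1/2)^n + (1/2)^m"
        using \<alpha>[of n] \<alpha>[of m] by simp
      also have "\<dots> \<le> 2 * (1/2)^n"
        using power_decreasing[OF \<open>n \<le> m\<close>, of "1/2::real"] by simp
      finally show "dist (d (\<alpha> n)) (d (\<alpha> m)) \<le> 2 * (1/2)^n" .
    qed
    moreover have "(\<lambda>n. d (\<alpha> n)) \<longlonglongrightarrow> x"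
    proof (rule metric_tendsto_imp_tendsto[of "\<lambda>n. (1/2::real)^n" 0])
      show "(\<lambda>n. (1/2::real)^n) \<longlonglongrightarrow> 0" by (rule LIMSEQ_power_zero) simp
      show "\<forall>\<^sub>F n in sequentially. dist (d (\<alpha> n)) x \<le> dist ((1/2::real)^n) 0"
        using \<alpha> by (auto intro!: always_eventually less_imp_le simp del: dist_0_norm simp: dist_real_def)
    qed
    ultimately show ?thesis
      by (intro image_eqI[of _ _ \<alpha>]) (simp_all add: limI)
  qed
  then show ?thesis
    unfolding analytic_def using \<open>closed C\<close> cont by (intro exI) auto
qed

lemma closed_imp_analytic: "closed F \<Longrightarrow> analytic (F :: 'x::{complete_space, second_countable_topology} set)"
  using analytic_Int_closed[OF analytic_UNIV] by auto

lemma open_imp_analytic: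
  fixes U :: "'x::{complete_space, second_countable_topology} set"
  assumes "open U"
  shows "analytic U"
proof (cases "U = UNIV")
  case False
  have "U = (\<Union>n. {x. infdist x (- U) \<ge> 1 / Suc n})"
  proof safe
    fix x assume "x \<in> U"
    then have "infdist x (- U) \<noteq> 0"
      using assms False by (subst in_closed_iff_infdist_zero[symmetric]) auto
    then have "0 < infdist x (- U)"
      using infdist_nonneg[of x "- U"] by simp
    then show "x \<in> (\<Union>n. {x. infdist x (- U) \<ge> 1 / Suc n})"
      using nat_approx_posE by (metis (mono_tags, lifting) UN_I UNIV_I less_eq_real_def mem_Collect_eq)
  next
    fix n x assume "1 / real (Suc n) \<le> infdist x (- U)"
    then have "infdist x (-U) \<noteq> 0" by (smt (verit) of_nat_0_less_iff zero_less_Suc zero_less_divide_1_iff)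
    then show "x \<in> U" by (metis ComplI infdist_zero)
  qed
  moreover have "closed {x. infdist x (- U) \<ge> 1 / Suc n}" for n
    by (intro closed_Collect_le continuous_intros)
  ultimately show ?thesis
    using analytic_UN[of "\<lambda>n. {x. infdist x (- U) \<ge> 1 / Suc n}"] closed_imp_analytic by auto
qed (simp add: analytic_UNIV)

lemma borel_imp_analytic:
  fixes B :: "'x::{complete_space, second_countable_topology} set"
  assumes "B \<in> sets borel"
  shows "analytic B"
proof -
  have "B \<in> sigma_sets UNIV {S :: 'x set. open S}"
    using assms by (simp add: borel_def)
  then have "analytic B \<and> analytic (- B)"
  proof (induction rule: sigma_sets.induct)
    case (Basic a)
    then show ?case by (auto intro: open_imp_analytic closed_imp_analytic)
  next
    case Empty
    then show ?case by (auto intro: open_imp_analytic)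
  next
    case (Compl a)
    then show ?case by (simp add: Compl_eq_Diff_UNIV[symmetric])
  next
    case (Union a)
    then show ?case by (auto intro!: analytic_UN analytic_INT simp: Compl_UN)
  qed
  then show ?thesis ..
qed

lemma analytic_Int:
  fixes A B :: "'x::metric_space set"
  assumes "analytic A" "analytic B"
  shows "analytic (A \<inter> B)"
proof -
  have "analytic (\<Inter>n::nat. if n = 0 then A else B)"
    using assms by (intro analytic_INT) auto
  moreover have "(\<Inter>n::nat. if n = 0 then A else B) = A \<inter> B"
    by (auto split: if_splits)
  ultimately show ?thesis by simp
qed

text \<open>The property of a sequence of sets that Novikov's theorem derives from analyticity and an empty
  intersection.\<close>

definition borel_separable :: "(nat \<Rightarrow> 'x::topological_space set) \<Rightarrow> bool" where
  "borel_separable A \<longleftrightarrow> (\<exists>B. (\<forall>n. B n \<in> sets borel \<and> A n \<subseteq> B n) \<and> (\<Inter>n. B n) = {})"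

lemma borel_separableI:
  assumes "\<And>n. B n \<in> sets borel" "\<And>n. A n \<subseteq> B n" "\<And>x. \<exists>n. x \<notin> B n"
  shows "borel_separable A"
  unfolding borel_separable_def using assms by (intro exI[of _ B]) (simp add: set_eq_iff)

text \<open>The splitting step: if replacing \<open>A k\<close> by any of the pieces \<open>A' j\<close> that cover it gives a separable
  sequence, the sequence itself is separable.\<close>

lemma borel_separable_split:
  fixes A :: "nat \<Rightarrow> 'x::topological_space set"
  assumes A: "A k \<subseteq> (\<Union>j::nat. A' j)" and sep: "\<And>j. borel_separable (A(k := A' j))"
  shows "borel_separable A"
proof -
  have "\<forall>j. \<exists>B. (\<forall>n. B n \<in> sets borel \<and> (A(k := A' j)) n \<subseteq> B n) \<and> (\<Inter>n. B n) = {}"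
    using sep unfolding borel_separable_def by blast
  then obtain B where B: "\<And>j n. B j n \<in> sets borel" "\<And>j n. (A(k := A' j)) n \<subseteq> B j n"
    "\<And>j. (\<Inter>n. B j n) = {}"
    by metis
  define C where "C n = (if n = k then \<Union>j. B j k else \<Inter>j. B j n)" for n
  have "C n \<in> sets borel" for n
    using B(1) by (auto simp: C_def intro!: sets.countable_INT')
  moreover have "A n \<subseteq> C n" for n
  proof (cases "n = k")
    case True
    then show ?thesis
      using A B(2)[where n=k] by (fastforce simp: C_def)
  next
    case False
    then show ?thesis
      using B(2)[where n=n] by (fastforce simp: C_def)
  qed
  moreover have "x \<notin> (\<Inter>n. C n)" for x
  proof
    assume x: "x \<in> (\<Inter>n. C n)"
    then have "x \<in> C k" by auto
    then obtain j where "x \<in> B j k" by (auto simp: C_def)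
    moreover have "x \<in> B j n" if "n \<noteq> k" for n
      using x that by (auto simp: C_def dest!: spec[of _ n])
    ultimately have "x \<in> B j n" for n by metis
    then show False using B(3) by auto
  qed
  ultimately show ?thesis
    unfolding borel_separable_def by (intro exI[of _ C]) (simp add: set_eq_iff)
qed

text \<open>If the sequence were not separable, repeated splitting would give one point \<open>\<beta> n\<close> of Baire space for
  each \<open>n\<close> such that the images of arbitrarily small neighbourhoods of these points remain inseparable.
  But since the \<open>A n\<close> have no common point, two of the image points differ, and disjoint open
  neighbourhoods of these two already separate.\<close>

theorem novikov_separation:
  fixes A :: "nat \<Rightarrow> 'x::t2_space set"
  assumes an: "\<And>n. analytic (A n)" and disj: "(\<Inter>n. A n) = {}"
  shows "borel_separable A"
proof (rule ccontr)
  assume nsep: "\<not> borel_separable A"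
  have "\<forall>n. \<exists>(C :: (nat \<Rightarrow> nat) set) f. closed C \<and> continuous_on C f \<and> A n = f ` C"
    using an unfolding analytic_def by blast
  then obtain C :: "nat \<Rightarrow> (nat \<Rightarrow> nat) set" and f where
    C: "\<And>n. closed (C n)" "\<And>n. continuous_on (C n) (f n)" "\<And>n. A n = f n ` C n"
    by metis
  \<comment> \<open>The sequence \<open>\<gamma>\<close> interleaves one point of Baire space per set; at stage \<open>m\<close> only the entries
    of \<open>\<gamma>\<close> below \<open>m\<close> are prescribed.\<close>
  define R where "R m \<gamma> n = f n ` {\<alpha> \<in> C n. \<forall>i. prod_encode (n, i) < m \<longrightarrow> \<alpha> i = \<gamma> (prod_encode (n, i))}"
    for m and \<gamma> :: "nat \<Rightarrow> nat" and n
  have step: "\<exists>j. \<not> borel_separable (R (Suc m) (\<gamma>(m := j)))" if "\<not> borel_separable (R m \<gamma>)" for m \<gamma>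
  proof (rule ccontr)
    assume *: "\<nexists>j. \<not> borel_separable (R (Suc m) (\<gamma>(m := j)))"
    obtain k i where ki: "m = prod_encode (k, i)"
      by (metis prod_decode_inverse surj_pair)
    have eq: "R (Suc m) (\<gamma>(m := j)) = (R m \<gamma>)(k := R (Suc m) (\<gamma>(m := j)) k)" for j
    proof
      fix n
      show "R (Suc m) (\<gamma>(m := j)) n = ((R m \<gamma>)(k := R (Suc m) (\<gamma>(m := j)) k)) n"
      proof (cases "n = k")
        case False
        then have "prod_encode (n, i') < Suc m \<longleftrightarrow> prod_encode (n, i') < m" for i'
          unfolding ki less_Suc_eq by auto
        then show ?thesis
          using False unfolding R_def by (auto intro!: arg_cong[where f="(`) (f n)"])
      qed simp
    qed
    have "R m \<gamma> k \<subseteq> (\<Union>j. R (Suc m) (\<gamma>(m := j)) k)"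
    proof
      fix x assume "x \<in> R m \<gamma> k"
      then obtain \<alpha> where \<alpha>: "\<alpha> \<in> C k" "\<forall>i. prod_encode (k, i) < m \<longrightarrow> \<alpha> i = \<gamma> (prod_encode (k, i))"
        "x = f k \<alpha>"
        by (auto simp: R_def)
      have "x \<in> R (Suc m) (\<gamma>(m := \<alpha> i)) k"
        unfolding R_def using \<alpha> by (intro image_eqI[of _ _ \<alpha>]) (auto simp: less_Suc_eq ki)
      then show "x \<in> (\<Union>j. R (Suc m) (\<gamma>(m := j)) k)" by auto
    qed
    moreover have "borel_separable ((R m \<gamma>)(k := R (Suc m) (\<gamma>(m := j)) k))" for j
      using * eq[of j] by metis
    ultimately have "borel_separable (R m \<gamma>)"
      by (rule borel_separable_split)
    with that show False by simp
  qed
  have R0: "R 0 (\<lambda>_. 0) = A"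
    by (auto simp: R_def C(3) fun_eq_iff)
  have "\<exists>g. \<forall>m. \<not> borel_separable (R m (g m)) \<and> (\<exists>j. g (Suc m) = (g m)(m := j))"
  proof (rule dependent_nat_choice)
    show "\<exists>\<gamma>. \<not> borel_separable (R 0 \<gamma>)"
      using nsep R0 by metis
    show "\<exists>y. \<not> borel_separable (R (Suc n) y) \<and> (\<exists>j. y = x(n := j))"
      if "\<not> borel_separable (R n x)" for x n
      using step[OF that] by blast
  qed
  then obtain g where g: "\<And>m. \<not> borel_separable (R m (g m))" "\<And>m. \<exists>j. g (Suc m) = (g m)(m := j)"
    by auto
  define \<gamma> where "\<gamma> i = g (Suc i) i" for i
  have stable: "g m i = \<gamma> i" if "i < m" for i m
    using that
  proof (induction m)
    case (Suc m)
    show ?case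
    proof (cases "i = m")
      case True
      then show ?thesis by (simp add: \<gamma>_def)
    next
      case False
      then have "g (Suc m) i = g m i"
        using g(2)[of m] by auto
      then show ?thesis
        using Suc False by simp
    qed
  qed simp
  have "R m (g m) = R m \<gamma>" for m
    unfolding R_def by (intro ext) (simp add: stable cong: conj_cong imp_cong)
  with g(1) have nsep': "\<not> borel_separable (R m \<gamma>)" for m by simp
  define \<beta> where "\<beta> n = (\<lambda>i. \<gamma> (prod_encode (n, i)))" for n
  have small: "\<exists>m. \<forall>m'\<ge>m. R m' \<gamma> n \<subseteq> f n ` (C n \<inter> U)" if U: "open U" "\<beta> n \<in> U" for U n
  proof -
    obtain k where k: "\<And>\<alpha>. (\<forall>i<k. \<alpha> i = \<beta> n i) \<Longrightarrow> \<alpha> \<in> U"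
      using open_seq_contains_cylinder[OF U] by blast
    obtain m where m: "\<And>i. i < k \<Longrightarrow> prod_encode (n, i) < m"
      using finite_nat_iff_bounded[of "(\<lambda>i. prod_encode (n, i)) ` {..<k}"] by auto
    have "R m' \<gamma> n \<subseteq> f n ` (C n \<inter> U)" if "m \<le> m'" for m'
      unfolding R_def
    proof (intro image_mono subsetI IntI)
      fix \<alpha> assume \<alpha>: "\<alpha> \<in> {\<alpha> \<in> C n. \<forall>i. prod_encode (n, i) < m' \<longrightarrow> \<alpha> i = \<gamma> (prod_encode (n, i))}"
      show "\<alpha> \<in> C n" using \<alpha> by simp
      show "\<alpha> \<in> U"
      proof (rule k, intro allI impI)
        fix i assume "i < k"
        then have "prod_encode (n, i) < m'" using m that by (meson less_le_trans)
        then show "\<alpha> i = \<beta> n i" using \<alpha> by (auto simp: \<beta>_def)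
      qed
    qed
    then show ?thesis by blast
  qed
  show False
  proof (cases "\<forall>n. \<beta> n \<in> C n")
    case False
    then obtain n where n: "\<beta> n \<in> - C n" by auto
    have "open (- C n)" using C(1) by (rule open_Compl)
    from small[OF this n] obtain m where "\<forall>m'\<ge>m. R m' \<gamma> n \<subseteq> f n ` (C n \<inter> - C n)" ..
    then have "R m \<gamma> n \<subseteq> f n ` (C n \<inter> - C n)" by simp
    then have "R m \<gamma> n = {}" by simp
    then have "borel_separable (R m \<gamma>)"
      by (intro borel_separableI[of "\<lambda>i. if i = n then {} else UNIV"] exI[of _ n]) simp_all
    then show False using nsep' by simp
  next
    case True
    have "\<exists>i j. f i (\<beta> i) \<noteq> f j (\<beta> j)"
    proof (rule ccontr)
      assume "\<nexists>i j. f i (\<beta> i) \<noteq> f j (\<beta> j)"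
      then have "f 0 (\<beta> 0) = f n (\<beta> n)" for n by blast
      then have "f 0 (\<beta> 0) \<in> A n" for n
        using True C(3) by auto
      then show False using disj by auto
    qed
    then obtain i j where ij: "f i (\<beta> i) \<noteq> f j (\<beta> j)" by blast
    then obtain U V where UV: "open U" "open V" "f i (\<beta> i) \<in> U" "f j (\<beta> j) \<in> V" "U \<inter> V = {}"
      using hausdorff by metis
    have near: "\<exists>m. \<forall>m'\<ge>m. R m' \<gamma> n \<subseteq> W" if W: "open W" "f n (\<beta> n) \<in> W" for n W
    proof -
      obtain T where T: "open T" "T \<inter> C n = f n -` W \<inter> C n"
        using C(2)[of n, unfolded continuous_on_open_invariant, rule_format, OF W(1)] by blast
      then have "\<beta> n \<in> T" using True W(2) by blast
      from small[OF T(1) this] obtain m where m: "\<forall>m'\<ge>m. R m' \<gamma> n \<subseteq> f n ` (C n \<inter> T)" ..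
      have "f n ` (C n \<inter> T) \<subseteq> W" using T(2) by auto
      with m have "\<forall>m'\<ge>m. R m' \<gamma> n \<subseteq> W" by (meson order_trans)
      then show ?thesis ..
    qed
    obtain m1 where "\<forall>m'\<ge>m1. R m' \<gamma> i \<subseteq> U"
      using near[OF UV(1,3)] ..
    moreover obtain m2 where "\<forall>m'\<ge>m2. R m' \<gamma> j \<subseteq> V"
      using near[OF UV(2,4)] ..
    ultimately have sub: "R (max m1 m2) \<gamma> i \<subseteq> U" "R (max m1 m2) \<gamma> j \<subseteq> V"
      by simp_all
    have "i \<noteq> j" using ij by auto
    have disj': "\<exists>n. x \<notin> (if n = i then U else if n = j then V else UNIV)" for x
    proof (cases "x \<in> U")
      case True
      then show ?thesis using UV(5) \<open>i \<noteq> j\<close> by (intro exI[of _ j]) auto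
    next
      case False
      then show ?thesis by (intro exI[of _ i]) simp
    qed
    have "borel_separable (R (max m1 m2) \<gamma>)"
      using UV(1,2) sub disj'
      by (intro borel_separableI[of "\<lambda>n. if n = i then U else if n = j then V else UNIV"]) simp_all
    then show False using nsep' by simp
  qed
qed

text \<open>Novikov's theorem in dual form, applied to the sets \<open>D - E n\<close>.\<close>

lemma borel_refinement_of_coanalytic_cover:
  fixes D :: "'x::{complete_space, second_countable_topology} set"
  assumes D: "D \<in> sets borel" and E: "\<And>n. analytic (- E n)" and cover: "D \<subseteq> (\<Union>n. E n)"
  shows "\<exists>B. (\<forall>n::nat. B n \<in> sets borel \<and> B n \<subseteq> E n) \<and> (\<Union>n. B n) = D"
proof -
  have "borel_separable (\<lambda>n. D \<inter> - E n)"
    using D E cover by (intro novikov_separation analytic_Int borel_imp_analytic[OF D]) auto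
  then obtain C where C: "\<And>n. C n \<in> sets borel" "\<And>n. D \<inter> - E n \<subseteq> C n" "(\<Inter>n. C n) = {}"
    unfolding borel_separable_def by auto
  show ?thesis
  proof (intro exI[of _ "\<lambda>n. D - C n"] conjI allI)
    show "D - C n \<in> sets borel" for n using D C by auto
    show "D - C n \<subseteq> E n" for n using C(2)[of n] by auto
    show "(\<Union>n. D - C n) = D" using C(3) by auto
  qed
qed

lemma analytic_Un:
  assumes "analytic A" "analytic A'"
  shows "analytic (A \<union> A')"
proof -
  have "analytic (\<Union>n::nat. if n = 0 then A else A')"
    using assms by (intro analytic_UN) auto
  moreover have "(\<Union>n::nat. if n = 0 then A else A') = A \<union> A'"
    by (auto split: if_splits)
  ultimately show ?thesis by simp
qed

lemma lusin_separation:
  fixes A A' :: "'x::t2_space set"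
  assumes "analytic A" "analytic A'" "A \<inter> A' = {}"
  shows "\<exists>B \<in> sets borel. A \<subseteq> B \<and> B \<inter> A' = {}"
proof -
  have "borel_separable (\<lambda>n::nat. if n = 0 then A else A')"
    using assms by (intro novikov_separation) (auto split: if_splits)
  then obtain C where C: "\<And>n. C n \<in> sets borel" "\<And>n. (if n = 0 then A else A') \<subseteq> C n" "(\<Inter>n::nat. C n) = {}"
    unfolding borel_separable_def by auto
  have "x \<notin> C 0" if "x \<in> A'" for x
  proof
    assume "x \<in> C 0"
    moreover have "x \<in> C n" if "n \<noteq> 0" for n
      using C(2)[of n] that \<open>x \<in> A'\<close> by auto
    ultimately have "x \<in> C n" for n by metis
    then show False using C(3) by auto
  qed
  then show ?thesis
    using C(1)[of 0] C(2)[of 0] by (intro bexI[of _ "C 0"]) auto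
qed

section \<open>Borel sets with compact sections\<close>

text \<open>In a complete space, a countable family of closed sets with the finite intersection property has a
  common point if it contains members that are covered by finitely many balls of arbitrarily small
  radius. A point chosen in each finite intersection gives a totally bounded sequence, and any
  accumulation point of that sequence is in all members.\<close>

lemma totally_bounded_fip:
  fixes C :: "'i::countable \<Rightarrow> 'y::complete_space set"
  assumes closed: "\<And>i. closed (C i)"
    and tb: "\<And>e. 0 < e \<Longrightarrow> \<exists>i\<in>I. \<exists>F. finite F \<and> C i \<subseteq> (\<Union>y\<in>F. cball y e)"
    and fip: "\<And>S. finite S \<Longrightarrow> S \<subseteq> I \<Longrightarrow> (\<Inter>i\<in>S. C i) \<noteq> {}"
  shows "(\<Inter>i\<in>I. C i) \<noteq> {}"
proof -
  define S where "S n = {i\<in>I. to_nat i \<le> n}" for n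
  have "finite (to_nat -` {..n} :: 'i set)" for n
    by (intro finite_vimageI) auto
  then have "finite (S n)" for n
    by (rule finite_subset[rotated]) (auto simp: S_def)
  then have "\<exists>y. y \<in> (\<Inter>i\<in>S n. C i)" for n
    using fip[of "S n"] by (auto simp: S_def)
  then obtain y where y: "\<And>n. y n \<in> (\<Inter>i\<in>S n. C i)"
    by metis
  have y': "y n \<in> C i" if "i \<in> I" "to_nat i \<le> n" for i n
    using y[of n] that by (auto simp: S_def)
  have "compact (closure (range y))"
    unfolding compact_eq_totally_bounded
  proof (intro conjI allI impI)
    show "Topological_Spaces.complete (closure (range y))"
      by (simp add: complete_eq_closed)
    fix e :: real assume "0 < e"
    then obtain i F where i: "i \<in> I" "finite F" "C i \<subseteq> (\<Union>y\<in>F. cball y (e/2))"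
      using tb[of "e/2"] by auto
    let ?F = "F \<union> y ` {..<to_nat i}"
    have "y n \<in> (\<Union>y\<in>?F. cball y (e/2))" for n
    proof (cases "to_nat i \<le> n")
      case True
      then have "y n \<in> C i" by (rule y'[OF i(1)])
      then show ?thesis using i(3) by blast
    next
      case False
      then show ?thesis using \<open>0 < e\<close> by (intro UN_I[of "y n"]) auto
    qed
    then have "range y \<subseteq> (\<Union>y\<in>?F. cball y (e/2))"
      by blast
    then have "closure (range y) \<subseteq> (\<Union>y\<in>?F. cball y (e/2))"
      by (rule closure_minimal) (use i(2) in \<open>intro closed_UN, auto\<close>)
    also have "\<dots> \<subseteq> (\<Union>y\<in>?F. ball y e)"
      using \<open>0 < e\<close> by (intro UN_mono order_refl) auto
    finally show "\<exists>k. finite k \<and> closure (range y) \<subseteq> (\<Union>x\<in>k. ball x e)"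
      using i(2) by (intro exI[of _ ?F]) auto
  qed
  then have "seq_compact (closure (range y))"
    by (rule compact_imp_seq_compact)
  moreover have "\<forall>n. y n \<in> closure (range y)"
    using closure_subset[of "range y"] by blast
  ultimately obtain l and r :: "nat \<Rightarrow> nat" where l: "strict_mono r" "(y \<circ> r) \<longlonglongrightarrow> l"
    unfolding seq_compact_def by meson
  have "l \<in> C i" if "i \<in> I" for i
  proof (rule Lim_in_closed_set[OF closed _ _ l(2)])
    have "(y \<circ> r) n \<in> C i" if "to_nat i \<le> n" for n
      using y'[OF \<open>i \<in> I\<close>, of "r n"] seq_suble[OF l(1), of n] that by auto
    then show "\<forall>\<^sub>F n in sequentially. (y \<circ> r) n \<in> C i"
      by (auto simp: eventually_sequentially)
  qed simp
  then show ?thesis by auto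
qed

lemma analytic_projection_of_borel:
  fixes B :: "('x::{complete_space, second_countable_topology} \<times> 'y::{complete_space, second_countable_topology}) set"
  assumes "B \<in> sets borel"
  shows "analytic (fst ` B)"
  using assms by (intro analytic_continuous_image borel_imp_analytic continuous_intros)

lemma borel_Int_UNIV_Times:
  fixes B :: "('x::second_countable_topology \<times> 'y::second_countable_topology) set"
  assumes "B \<in> sets borel" "T \<in> sets borel"
  shows "B \<inter> UNIV \<times> T \<in> sets borel"
  using assms by (simp add: borel_prod[symmetric])

text \<open>The complement of a Borel set with closed sections is a countable union of Borel rectangles
  \<open>G n \<times> V n\<close>, where \<open>V\<close> is any countable base. With \<open>P n\<close> the set of points whose section meets \<open>V n\<close>,
  the complement is covered by the co-analytic rectangles \<open>(- P n) \<times> V n\<close>; a Borel refinement of this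
  cover is projected, and its projections are separated from the analytic sets \<open>P n\<close>.\<close>

theorem kunugui_novikov:
  fixes B :: "('x::{complete_space, second_countable_topology} \<times> 'y::{complete_space, second_countable_topology}) set"
  assumes B: "B \<in> sets borel" and closed: "\<And>x. closed {y. (x, y) \<in> B}"
    and V: "\<And>n::nat. open (V n)" "\<And>U y. open U \<Longrightarrow> y \<in> U \<Longrightarrow> \<exists>n. y \<in> V n \<and> V n \<subseteq> U"
  shows "\<exists>G. (\<forall>n. G n \<in> sets borel) \<and> - B = (\<Union>n. G n \<times> V n)"
proof -
  define P where "P n = fst ` (B \<inter> UNIV \<times> V n)" for n
  have P: "analytic (P n)" for n
    unfolding P_def by (intro analytic_projection_of_borel borel_Int_UNIV_Times B) (simp add: V)
  define E where "E n = (- P n) \<times> V n" for n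
  have E: "analytic (- E n)" for n
  proof -
    let ?S = "{p :: 'x \<times> 'y \<times> 'y. (fst p, fst (snd p)) \<in> B \<inter> UNIV \<times> V n}"
    have m: "(\<lambda>p :: 'x \<times> 'y \<times> 'y. (fst p, fst (snd p))) \<in> borel \<rightarrow>\<^sub>M borel"
      by (intro borel_measurable_continuous_onI continuous_intros)
    have "?S \<in> sets borel"
      using measurable_sets[OF m, of "B \<inter> UNIV \<times> V n"] borel_Int_UNIV_Times[OF B, of "V n"] V(1)
      by (simp add: vimage_def)
    then have "analytic ((\<lambda>p. (fst p, snd (snd p))) ` ?S)"
      by (intro analytic_continuous_image borel_imp_analytic continuous_intros)
    moreover have "(\<lambda>p. (fst p, snd (snd p))) ` ?S = P n \<times> UNIV"
      by (force simp: P_def image_iff)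
    ultimately have 1: "analytic (P n \<times> (UNIV :: 'y set))" by simp
    have "closed ((UNIV :: 'x set) \<times> (- V n))"
      by (intro closed_Times) (use V in auto)
    then have "analytic ((UNIV :: 'x set) \<times> (- V n))"
      by (rule closed_imp_analytic)
    from analytic_Un[OF 1 this] show ?thesis
      by (rule arg_cong[where f=analytic, THEN iffD1, rotated]) (auto simp: E_def)
  qed
  have "- B \<subseteq> (\<Union>n. E n)"
  proof
    fix p assume p: "p \<in> - B"
    obtain x y where xy: "p = (x, y)" by (cases p)
    have "open (- {y. (x, y) \<in> B})" "y \<in> - {y. (x, y) \<in> B}"
      using closed p xy by auto
    from V(2)[OF this] obtain n where n: "y \<in> V n" "V n \<subseteq> - {y. (x, y) \<in> B}" by auto
    then have "x \<notin> P n" by (auto simp: P_def)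
    with n xy show "p \<in> (\<Union>n. E n)" by (auto simp: E_def)
  qed
  then have "\<exists>D. (\<forall>n. D n \<in> sets borel \<and> D n \<subseteq> E n) \<and> (\<Union>n. D n) = - B"
    using B E by (intro borel_refinement_of_coanalytic_cover) auto
  then obtain D where D: "\<forall>n. D n \<in> sets borel \<and> D n \<subseteq> E n" "(\<Union>n. D n) = - B"
    by (elim exE conjE)
  have "\<exists>G. G \<in> sets borel \<and> fst ` D n \<subseteq> G \<and> G \<inter> P n = {}" for n
  proof -
    have "analytic (fst ` D n)"
      using D by (intro analytic_projection_of_borel) auto
    moreover have "fst ` D n \<inter> P n = {}"
      using D(1) by (force simp: E_def)
    ultimately have "\<exists>G \<in> sets borel. fst ` D n \<subseteq> G \<and> G \<inter> P n = {}"
      using P by (intro lusin_separation)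
    then show ?thesis by (simp only: Bex_def)
  qed
  then obtain G where G: "\<And>n. G n \<in> sets borel" "\<And>n. fst ` D n \<subseteq> G n" "\<And>n. G n \<inter> P n = {}"
    by metis
  have "- B = (\<Union>n. G n \<times> V n)"
  proof (intro set_eqI iffI)
    fix p assume "p \<in> - B"
    then obtain n where n: "p \<in> D n" using D(2) by blast
    then have "fst p \<in> G n" using G(2)[of n] by blast
    moreover have "p \<in> (- P n) \<times> V n" using n D(1) unfolding E_def by blast
    ultimately show "p \<in> (\<Union>n. G n \<times> V n)" by (auto simp: mem_Times_iff)
  next
    fix p assume "p \<in> (\<Union>n. G n \<times> V n)"
    then obtain n where n: "fst p \<in> G n" "snd p \<in> V n" by auto
    then have "fst p \<notin> P n" using G(3)[of n] by blast
    then show "p \<in> - B" using n(2) by (auto simp: P_def image_iff mem_Times_iff)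
  qed
  then show ?thesis using G(1) by blast
qed

lemma countable_base_sequence:
  "\<exists>V :: nat \<Rightarrow> 'y::{metric_space, second_countable_topology} set.
    (\<forall>n. open (V n)) \<and> (\<forall>U y. open U \<longrightarrow> y \<in> U \<longrightarrow> (\<exists>n. y \<in> V n \<and> V n \<subseteq> U))"
proof -
  obtain \<B> :: "'y set set" where B: "countable \<B>" "topological_basis \<B>"
    using ex_countable_basis by auto
  have "\<B> \<noteq> {}"
    using topological_basisE[OF B(2) open_UNIV, of undefined] by auto
  show ?thesis
  proof (intro exI[of _ "from_nat_into \<B>"] conjI allI impI)
    show "open (from_nat_into \<B> n)" for n
      using from_nat_into[OF \<open>\<B> \<noteq> {}\<close>, of n] B(2) topological_basis_open by blast
    fix U :: "'y set" and y assume "open U" "y \<in> U"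
    then obtain W where "W \<in> \<B>" "y \<in> W" "W \<subseteq> U"
      using topological_basisE[OF B(2)] by metis
    then show "\<exists>n. y \<in> from_nat_into \<B> n \<and> from_nat_into \<B> n \<subseteq> U"
      using from_nat_into_surj[OF B(1), of W] by metis
  qed
qed

text \<open>The emptiness of a compact section is detected by countably many Borel conditions. By
  \<open>kunugui_novikov\<close> the section over \<open>x\<close> is the intersection of the closed sets \<open>- V n\<close> with \<open>x \<in> G n\<close>. By
  compactness, for each \<open>k\<close> the space is covered by the co-analytic sets \<open>T k N\<close> of points whose section
  lies in the first \<open>N\<close> balls of radius \<open>1 / (k + 1)\<close> around a dense sequence, and these sets can be
  shrunk to Borel sets \<open>H k N\<close>. Hence the section is empty if and only if finitely many of these closed conditions on it are already
  incompatible.\<close>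

theorem borel_projection_of_compact_sections:
  fixes B :: "('x::{complete_space, second_countable_topology} \<times> 'y::{complete_space, second_countable_topology}) set"
  assumes B: "B \<in> sets borel" and compact: "\<And>x. compact {y. (x, y) \<in> B}"
  shows "fst ` B \<in> sets borel"
proof -
  obtain d :: "nat \<Rightarrow> 'y" where d: "\<forall>x e. 0 < e \<longrightarrow> (\<exists>n. dist (d n) x < e)"
    using dense_sequence by blast
  obtain V :: "nat \<Rightarrow> 'y set" where
    V: "\<And>n. open (V n)" "\<And>U y. open U \<Longrightarrow> y \<in> U \<Longrightarrow> \<exists>n. y \<in> V n \<and> V n \<subseteq> U"
    using countable_base_sequence by metis
  have "\<exists>G. (\<forall>n. G n \<in> sets borel) \<and> - B = (\<Union>n. G n \<times> V n)"
    using V by (intro kunugui_novikov B compact_imp_closed compact)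
  then obtain G where G: "\<And>n. G n \<in> sets borel" "- B = (\<Union>n. G n \<times> V n)"
    by blast
  define W where "W k N = (\<Union>n<N. cball (d n) (1 / Suc k))" for k N
  have W: "closed (W k N)" for k N
    unfolding W_def by (intro closed_UN) auto
  define T where "T k N = {x. {y. (x, y) \<in> B} \<subseteq> W k N}" for k N
  have "analytic (- T k N)" for k N
  proof -
    have "- T k N = fst ` (B \<inter> UNIV \<times> (- W k N))"
      by (force simp: T_def)
    then show ?thesis
      using W[of k N] by (auto intro!: analytic_projection_of_borel borel_Int_UNIV_Times B)
  qed
  moreover have "UNIV \<subseteq> (\<Union>N. T k N)" for k
  proof
    fix x
    have "{y. (x, y) \<in> B} \<subseteq> (\<Union>n. ball (d n) (1 / Suc k))"
    proof
      fix y
      have "\<exists>n. dist (d n) y < 1 / Suc k" using d by simp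
      then show "y \<in> (\<Union>n. ball (d n) (1 / Suc k))" by auto
    qed
    then obtain F where F: "finite F" "{y. (x, y) \<in> B} \<subseteq> (\<Union>n\<in>F. ball (d n) (1 / Suc k))"
      using compactE_image[OF compact, of UNIV "\<lambda>n. ball (d n) (1 / Suc k)" x] by auto
    obtain N where "F \<subseteq> {..<N}"
      using F(1) finite_nat_iff_bounded by auto
    then have "(\<Union>n\<in>F. ball (d n) (1 / Suc k)) \<subseteq> W k N"
      unfolding W_def by (intro UN_mono) auto
    then have "x \<in> T k N"
      using F(2) unfolding T_def by simp
    then show "x \<in> (\<Union>N. T k N)" by blast
  qed
  ultimately have "\<exists>H. (\<forall>N. H N \<in> sets borel \<and> H N \<subseteq> T k N) \<and> (\<Union>N. H N) = UNIV" for k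
    by (intro borel_refinement_of_coanalytic_cover) auto
  then obtain H where H: "\<And>k N. H k N \<in> sets borel" "\<And>k N. H k N \<subseteq> T k N" "\<And>k. (\<Union>N. H k N) = UNIV"
    by metis
  \<comment> \<open>Both kinds of conditions in one family: over the Borel set \<open>K i\<close> the sections lie in the closed
    set \<open>C i\<close>.\<close>
  define C :: "nat + nat \<times> nat \<Rightarrow> 'y set" where
    "C i = (case i of Inl n \<Rightarrow> - V n | Inr (k, N) \<Rightarrow> W k N)" for i
  define K where "K i = (case i of Inl n \<Rightarrow> G n | Inr (k, N) \<Rightarrow> H k N)" for i
  have C: "closed (C i)" for i
    using V(1) W by (auto simp: C_def split: sum.split)
  have K: "K i \<in> sets borel" for i
    using G(1) H(1) by (auto simp: K_def split: sum.split)
  have sec: "{y. (x, y) \<in> B} \<subseteq> C i" if "x \<in> K i" for x i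
  proof (cases i)
    case (Inl n)
    have "G n \<times> V n \<subseteq> - B" using G(2) by blast
    with Inl that show ?thesis by (auto simp: C_def K_def)
  next
    case (Inr p)
    then show ?thesis using that H(2)[of "fst p" "snd p"] by (auto simp: C_def K_def T_def split: prod.splits)
  qed
  have sec': "(\<Inter>i\<in>{i. x \<in> K i}. C i) \<subseteq> {y. (x, y) \<in> B}" for x
  proof
    fix y assume y: "y \<in> (\<Inter>i\<in>{i. x \<in> K i}. C i)"
    show "y \<in> {y. (x, y) \<in> B}"
    proof (rule ccontr)
      assume "y \<notin> {y. (x, y) \<in> B}"
      then have "(x, y) \<in> (\<Union>n. G n \<times> V n)" unfolding G(2)[symmetric] by simp
      then obtain n where n: "x \<in> G n" "y \<in> V n" by blast
      then have "y \<in> C (Inl n)" using y by (auto simp: K_def)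
      then show False using n by (simp add: C_def)
    qed
  qed
  have "- (fst ` B) = (\<Union>S\<in>{S. finite S \<and> (\<Inter>i\<in>S. C i) = {}}. \<Inter>i\<in>S. K i)"
  proof (intro set_eqI iffI)
    fix x assume "x \<in> - (fst ` B)"
    then have "{y. (x, y) \<in> B} = {}" by force
    then have e: "(\<Inter>i\<in>{i. x \<in> K i}. C i) = {}" using sec'[of x] by simp
    have tb: "\<exists>i\<in>{i. x \<in> K i}. \<exists>F. finite F \<and> C i \<subseteq> (\<Union>y\<in>F. cball y e)" if e: "0 < e" for e
    proof -
      obtain k where k: "1 / Suc k < e" using nat_approx_posE[OF e] by auto
      obtain N where N: "x \<in> H k N" using H(3)[of k] by blast
      have "W k N \<subseteq> (\<Union>y\<in>d ` {..<N}. cball y e)"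
        unfolding W_def image_image UN_extend_simps(10)
        by (intro UN_mono order_refl subset_cball) (use k in simp)
      then show ?thesis using N
        by (intro bexI[of _ "Inr (k, N)"] exI[of _ "d ` {..<N}"]) (auto simp: C_def K_def)
    qed
    have "\<exists>S. finite S \<and> S \<subseteq> {i. x \<in> K i} \<and> (\<Inter>i\<in>S. C i) = {}"
    proof (rule ccontr)
      assume *: "\<nexists>S. finite S \<and> S \<subseteq> {i. x \<in> K i} \<and> (\<Inter>i\<in>S. C i) = {}"
      have "(\<Inter>i\<in>{i. x \<in> K i}. C i) \<noteq> {}"
        by (rule totally_bounded_fip[OF C tb]) (use * in auto)
      with e show False by simp
    qed
    then show "x \<in> (\<Union>S\<in>{S. finite S \<and> (\<Inter>i\<in>S. C i) = {}}. \<Inter>i\<in>S. K i)" by blast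
  next
    fix x assume "x \<in> (\<Union>S\<in>{S. finite S \<and> (\<Inter>i\<in>S. C i) = {}}. \<Inter>i\<in>S. K i)"
    then obtain S where S: "(\<Inter>i\<in>S. C i) = {}" "\<And>i. i \<in> S \<Longrightarrow> x \<in> K i" by blast
    have "{y. (x, y) \<in> B} \<subseteq> (\<Inter>i\<in>S. C i)" using sec S(2) by blast
    then show "x \<in> - (fst ` B)" using S(1) by auto
  qed
  moreover have "(\<Union>S\<in>{S. finite S \<and> (\<Inter>i\<in>S. C i) = {}}. \<Inter>i\<in>S. K i) \<in> sets borel"
  proof (rule sets.countable_UN')
    show "countable {S. finite S \<and> (\<Inter>i\<in>S. C i) = {}}"
      by (rule countable_subset[OF _ countable_Collect_finite]) auto
    have "(\<Inter>i\<in>S. K i) \<in> sets borel" if S: "S \<in> {S. finite S \<and> (\<Inter>i\<in>S. C i) = {}}" for S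
    proof (rule sets.finite_INT)
      show "finite S" using S by simp
      show "S \<noteq> {}" using S by auto
    qed (rule K)
    then show "(\<lambda>S. \<Inter>i\<in>S. K i) ` {S. finite S \<and> (\<Inter>i\<in>S. C i) = {}} \<subseteq> sets borel"
      by blast
  qed
  ultimately have "- (fst ` B) \<in> sets borel" by simp
  from borel_comp[OF this] show ?thesis by simp
qed

text \<open>The set is cut down repeatedly: at stage \<open>k\<close> each section is intersected with the first ball of
  radius \<open>1 / (k + 1)\<close>, centred in a dense sequence, that it meets. By the projection theorem, the index
  of this ball is a Borel function of the point. By compactness a point of the section survives all
  stages, and it is the limit of the centres.\<close>

theorem borel_selector_of_compact_sections:
  fixes B :: "('x::{complete_space, second_countable_topology} \<times> 'y::{complete_space, second_countable_topology}) set"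
  assumes B: "B \<in> sets borel" and compact: "\<And>x. compact {y. (x, y) \<in> B}"
    and ne: "\<And>x. \<exists>y. (x, y) \<in> B"
  shows "\<exists>f \<in> borel_measurable borel. \<forall>x. (x, f x) \<in> B"
proof -
  obtain d :: "nat \<Rightarrow> 'y" where d: "\<forall>x e. 0 < e \<longrightarrow> (\<exists>n. dist (d n) x < e)"
    using dense_sequence by blast
  define near where "near k D x n \<longleftrightarrow> x \<in> fst ` (D \<inter> UNIV \<times> cball (d n) (1 / Suc k))"
    for k and D :: "('x \<times> 'y) set" and x n
  define N where "N k D x = (LEAST n. near k D x n)" for k D x
  define R where "R k D = {p \<in> D. dist (d (N k D (fst p))) (snd p) \<le> 1 / Suc k}" for k D
  define good where "good D \<longleftrightarrow> D \<in> sets borel \<and> (\<forall>x. compact {y. (x, y) \<in> D}) \<and> (\<forall>x. \<exists>y. (x, y) \<in> D)"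
    for D :: "('x \<times> 'y) set"
  have sec: "{y. (x, y) \<in> D \<inter> UNIV \<times> T} = {y. (x, y) \<in> D} \<inter> T" for D :: "('x \<times> 'y) set" and x T
    by auto
  have N: "(\<lambda>x. d (N k D x)) \<in> borel_measurable borel" if D: "good D" for k D
  proof -
    have "{x. near k D x n} \<in> sets borel" for n
      unfolding near_def Collect_mem_eq
    proof (rule borel_projection_of_compact_sections)
      show "D \<inter> UNIV \<times> cball (d n) (1 / real (Suc k)) \<in> sets borel"
        using D by (intro borel_Int_UNIV_Times) (auto simp: good_def)
      show "compact {y. (x, y) \<in> D \<inter> UNIV \<times> cball (d n) (1 / real (Suc k))}" for x
        unfolding sec using D by (intro compact_Int_closed) (auto simp: good_def)
    qed
    then have "Measurable.pred borel (\<lambda>x. near k D x n)" for n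
      by (simp add: pred_def)
    then have "N k D \<in> borel \<rightarrow>\<^sub>M count_space UNIV"
      unfolding N_def by (intro measurable_Least)
    then show ?thesis by (rule measurable_compose) simp
  qed
  have R: "good (R k D)" if D: "good D" for k D
    unfolding good_def
  proof (intro conjI allI)
    have "(\<lambda>p :: 'x \<times> 'y. dist (d (N k D (fst p))) (snd p)) \<in> borel_measurable borel"
      by (intro borel_measurable_dist measurable_compose[OF _ N[OF D]] borel_measurable_continuous_onI
          continuous_intros)
    then have "{p. dist (d (N k D (fst p))) (snd p) \<le> 1 / Suc k} \<in> sets borel"
      by simp
    moreover have "R k D = D \<inter> {p. dist (d (N k D (fst p))) (snd p) \<le> 1 / Suc k}"
      by (auto simp: R_def)
    ultimately show "R k D \<in> sets borel"
      using D by (auto simp: good_def)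
    fix x
    have eq: "{y. (x, y) \<in> R k D} = {y. (x, y) \<in> D} \<inter> cball (d (N k D x)) (1 / Suc k)"
      by (auto simp: R_def)
    show "compact {y. (x, y) \<in> R k D}"
      unfolding eq using D by (intro compact_Int_closed) (auto simp: good_def)
    obtain y where y: "(x, y) \<in> D" using D by (auto simp: good_def)
    obtain n where "dist (d n) y < 1 / Suc k" using d by (meson zero_less_Suc of_nat_0_less_iff zero_less_divide_1_iff)
    with y have "near k D x n" by (force simp: near_def)
    then have "near k D x (N k D x)" unfolding N_def by (rule LeastI)
    then show "\<exists>y. (x, y) \<in> R k D" using eq by (auto simp: near_def)
  qed
  define D where "D = rec_nat B R"
  have D_simps: "D 0 = B" "D (Suc k) = R k (D k)" for k
    by (simp_all add: D_def)
  have D: "good (D k)" for k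
  proof (induction k)
    case 0
    then show ?case using assms by (simp add: good_def D_simps)
  qed (simp add: D_simps R)
  have "decseq D"
    by (intro decseq_SucI) (auto simp: D_simps R_def)
  have "{y. (x, y) \<in> D 0} \<inter> (\<Inter>k\<in>UNIV. {y. (x, y) \<in> D k}) \<noteq> {}" for x
  proof (rule compact_imp_fip_image)
    show "compact {y. (x, y) \<in> D 0}" "closed {y. (x, y) \<in> D k}" for k
      using D by (auto simp: good_def intro: compact_imp_closed)
    fix I :: "nat set" assume "finite I"
    then obtain m where m: "I \<subseteq> {..<m}" using finite_nat_iff_bounded by auto
    obtain y where "(x, y) \<in> D m" using D[of m] by (auto simp: good_def)
    then have "(x, y) \<in> D k" if "k \<le> m" for k
      using decseqD[OF \<open>decseq D\<close> that] by blast
    then have "y \<in> {y. (x, y) \<in> D 0} \<inter> (\<Inter>k\<in>I. {y. (x, y) \<in> D k})"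
      using m by (auto dest!: subsetD)
    then show "{y. (x, y) \<in> D 0} \<inter> (\<Inter>k\<in>I. {y. (x, y) \<in> D k}) \<noteq> {}" by blast
  qed
  then have "\<exists>y. \<forall>k. (x, y) \<in> D k" for x by blast
  then obtain f where f: "\<And>x k. (x, f x) \<in> D k" by metis
  have "f \<in> borel_measurable borel"
  proof (rule borel_measurable_LIMSEQ_metric)
    show "(\<lambda>x. d (N k (D k) x)) \<in> borel_measurable borel" for k
      by (rule N[OF D])
    show "(\<lambda>k. d (N k (D k) x)) \<longlonglongrightarrow> f x" for x
    proof (rule metric_tendsto_imp_tendsto[of "\<lambda>k. 1 / real (Suc k)" 0])
      show "(\<lambda>k. 1 / real (Suc k)) \<longlonglongrightarrow> 0"
        using LIMSEQ_inverse_real_of_nat by (simp add: inverse_eq_divide)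
      have "dist (d (N k (D k) x)) (f x) \<le> 1 / Suc k" for k
        using f[of x "Suc k"] by (simp add: D_simps R_def)
      then show "\<forall>\<^sub>F k in sequentially. dist (d (N k (D k) x)) (f x) \<le> dist (1 / real (Suc k)) 0"
        by (intro always_eventually) (simp add: dist_real_def)
    qed
  qed
  moreover have "(x, f x) \<in> B" for x using f[of x 0] by (simp add: D_simps)
  ultimately show ?thesis by blast
qed

section \<open>Laws of trajectories\<close>

context Ionescu_Tulcea
begin

lemma restrict_measurable_lim: "(\<lambda>\<omega>. restrict \<omega> {0..<n}) \<in> PF.lim \<rightarrow>\<^sub>M PiM {0..<n} M"
  unfolding measurable_cong_sets[OF PF.sets_lim refl] by (rule measurable_restrict_subset) simp

lemma distr_lim_restrict:
  "distr PF.lim (PiM {0..<n} M) (\<lambda>\<omega>. restrict \<omega> {0..<n}) = C 0 n (\<lambda>x. undefined)"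
proof (rule measure_eqI)
  have u: "(\<lambda>x. undefined) \<in> space (PiM {0..<0} M)" by simp
  show "sets (distr PF.lim (PiM {0..<n} M) (\<lambda>\<omega>. restrict \<omega> {0..<n})) = sets (C 0 n (\<lambda>x. undefined))"
    using sets_C[OF u, of n] by simp
  fix A assume "A \<in> sets (distr PF.lim (PiM {0..<n} M) (\<lambda>\<omega>. restrict \<omega> {0..<n}))"
  then have A: "A \<in> sets (PiM {0..<n} M)" by simp
  have "emeasure (distr PF.lim (PiM {0..<n} M) (\<lambda>\<omega>. restrict \<omega> {0..<n})) A = emeasure PF.lim (PF.emb UNIV {0..<n} A)"
    using A by (simp add: emeasure_distr restrict_measurable_lim prod_emb_def space_PiM)
  also have "\<dots> = emeasure (CI {0..<n}) A"
    using A by (intro lim) auto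
  also have "\<dots> = emeasure (C 0 n (\<lambda>x. undefined)) (PF.emb {0..<n} {0..<n} A)"
    using A by (intro emeasure_CI) auto
  also have "PF.emb {0..<n} {0..<n} A = A"
    using sets.sets_into_space[OF A] by (intro prod_emb_id) (simp add: space_PiM)
  finally show "emeasure (distr PF.lim (PiM {0..<n} M) (\<lambda>\<omega>. restrict \<omega> {0..<n})) A = emeasure (C 0 n (\<lambda>x. undefined)) A" .
qed

lemma nn_integral_lim_restrict:
  assumes "f \<in> borel_measurable (PiM {0..<n} M)"
  shows "(\<integral>\<^sup>+\<omega>. f (restrict \<omega> {0..<n}) \<partial>PF.lim) = (\<integral>\<^sup>+\<omega>. f \<omega> \<partial>C 0 n (\<lambda>x. undefined))"
  unfolding distr_lim_restrict[symmetric]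
  by (rule nn_integral_distr[OF restrict_measurable_lim, symmetric]) (simp add: assms)

text \<open>The law of the first \<open>n + 1\<close> coordinates is obtained from the law of the trajectory by drawing
  coordinate \<open>n\<close> again from its conditional law.\<close>

lemma nn_integral_lim_step:
  assumes f: "f \<in> borel_measurable (PiM {0..<Suc n} M)"
  shows "(\<integral>\<^sup>+\<omega>. f (restrict \<omega> {0..<Suc n}) \<partial>PF.lim) =
    (\<integral>\<^sup>+\<omega>. (\<integral>\<^sup>+y. f ((restrict \<omega> {0..<n})(n := y)) \<partial>P n (restrict \<omega> {0..<n})) \<partial>PF.lim)"
proof -
  have u: "(\<lambda>x. undefined) \<in> space (PiM {0..<0} M)" by simp
  have g: "(\<lambda>\<omega>. \<integral>\<^sup>+y. f y \<partial>eP n \<omega>) \<in> borel_measurable (PiM {0..<n} M)"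
    by (rule measurable_compose[OF measurable_eP nn_integral_measurable_subprob_algebra[OF f]])
  have "(\<integral>\<^sup>+\<omega>. f (restrict \<omega> {0..<Suc n}) \<partial>PF.lim) = (\<integral>\<^sup>+\<omega>. f \<omega> \<partial>C 0 (Suc n) (\<lambda>x. undefined))"
    by (rule nn_integral_lim_restrict[OF f])
  also have "\<dots> = (\<integral>\<^sup>+\<omega>. \<integral>\<^sup>+y. f y \<partial>eP n \<omega> \<partial>C 0 n (\<lambda>x. undefined))"
  proof -
    have "eP n \<in> measurable (C 0 n (\<lambda>x. undefined)) (subprob_algebra (PiM {0..<Suc n} M))"
      using measurable_eP[of n] sets_C[OF u, of n] by (simp cong: measurable_cong_sets)
    from nn_integral_bind[OF f this] show ?thesis by simp
  qed
  also have "\<dots> = (\<integral>\<^sup>+\<omega>. \<integral>\<^sup>+y. f y \<partial>eP n (restrict \<omega> {0..<n}) \<partial>PF.lim)"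
    by (rule nn_integral_lim_restrict[OF g, symmetric])
  also have "\<dots> = (\<integral>\<^sup>+\<omega>. (\<integral>\<^sup>+y. f ((restrict \<omega> {0..<n})(n := y)) \<partial>P n (restrict \<omega> {0..<n})) \<partial>PF.lim)"
  proof (rule nn_integral_cong)
    fix \<omega> assume "\<omega> \<in> space PF.lim"
    then have "restrict \<omega> {0..<n} \<in> space (PiM {0..<n} M)"
      by (auto simp: space_PiM PiE_iff)
    then show "(\<integral>\<^sup>+y. f y \<partial>eP n (restrict \<omega> {0..<n})) = (\<integral>\<^sup>+y. f ((restrict \<omega> {0..<n})(n := y)) \<partial>P n (restrict \<omega> {0..<n}))"
      by (rule nn_integral_eP[OF _ f])
  qed
  finally show ?thesis .
qed

end

text \<open>The abbreviations follow the mathematical notation: \<open>X\<close> and \<open>A\<close> are the measurable spaces of states and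
  actions, \<open>S\<close> is the set of states outside the target, and \<open>K\<close> is the set of feasible pairs with state
  in \<open>S\<close>.\<close>

locale control =
  fixes M :: "('x::polish_space, 'a::polish_space, 'm) control_model_scheme"
  assumes model: "is_control_model M"
begin

abbreviation "X \<equiv> state_space M"
abbreviation "A \<equiv> action_space M"
abbreviation "S \<equiv> non_target M"
abbreviation "K \<equiv> active_pairs M"

lemma space_X: "space X = states M"
  by (simp add: state_space_def space_restrict_space)

lemma space_A: "space A = actions M"
  by (simp add: action_space_def space_restrict_space)

lemma borel_sets: "states M \<in> sets borel" "actions M \<in> sets borel" "target M \<in> sets borel"
    "feasible_pairs M \<in> sets borel"
  using model by (auto simp: is_control_model_def)

lemma feasible_sub: "x \<in> states M \<Longrightarrow> feasible M x \<subseteq> actions M"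
  and feasible_ne: "x \<in> states M \<Longrightarrow> feasible M x \<noteq> {}"
  using model by (auto simp: is_control_model_def)

lemma S_states: "x \<in> S \<Longrightarrow> x \<in> states M"
  by (simp add: non_target_def)

lemma S_borel: "S \<in> sets borel"
  using borel_sets by (auto simp: non_target_def)

lemma S_X [measurable]: "S \<in> sets X"
  using S_borel borel_sets(1) by (auto simp: state_space_def sets_restrict_space_iff non_target_def)

lemma K_iff: "(x, a) \<in> K \<longleftrightarrow> x \<in> S \<and> a \<in> feasible M x"
  by (simp add: active_pairs_def)

lemma K_borel: "K \<in> sets borel"
proof -
  have "target M \<times> (UNIV :: 'a set) \<in> sets borel"
    using borel_sets(3) by (simp add: borel_prod[symmetric])
  moreover have "K = feasible_pairs M - target M \<times> UNIV"
    by (auto simp: active_pairs_def feasible_pairs_def non_target_def)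
  ultimately show ?thesis using borel_sets by simp
qed

lemma id_XA: "(\<lambda>p. p) \<in> X \<Otimes>\<^sub>M A \<rightarrow>\<^sub>M borel"
proof -
  have idX: "(\<lambda>y. y) \<in> X \<rightarrow>\<^sub>M borel" and idA: "(\<lambda>a. a) \<in> A \<rightarrow>\<^sub>M borel"
    by (simp_all add: state_space_def action_space_def measurable_restrict_space1)
  show ?thesis
    unfolding borel_prod[symmetric] measurable_pair_iff comp_def
    using measurable_compose[OF measurable_fst idX] measurable_compose[OF measurable_snd idA] by auto
qed

lemma K_space: "K \<subseteq> space (X \<Otimes>\<^sub>M A)"
  using feasible_sub S_states by (fastforce simp: space_pair_measure space_X space_A active_pairs_def)

lemma K_XA [measurable]: "K \<in> sets (X \<Otimes>\<^sub>M A)"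
  using measurable_sets[OF id_XA K_borel] K_space by (simp add: Int_absorb2)

lemma trans_law_measurable: "trans_law M \<in> restrict_space borel K \<rightarrow>\<^sub>M prob_algebra X"
proof -
  have Q: "trans_law M \<in> restrict_space borel (feasible_pairs M) \<rightarrow>\<^sub>M prob_algebra X"
    using model by (simp add: is_control_model_def)
  have "K \<subseteq> feasible_pairs M"
    by (auto simp: active_pairs_def feasible_pairs_def non_target_def)
  then show ?thesis
    by (intro measurable_compose[OF _ Q] measurable_restrict_space2)
       (auto simp: space_restrict_space intro!: measurable_restrict_space1)
qed

lemma restrict_XA_K: "(\<lambda>p. p) \<in> restrict_space (X \<Otimes>\<^sub>M A) K \<rightarrow>\<^sub>M restrict_space borel K"
  by (intro measurable_restrict_space2 measurable_restrict_space1 id_XA)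
     (auto simp: space_restrict_space)

lemma trans_law_prob:
  assumes "p \<in> K"
  shows "sets (trans_law M p) = sets X" "prob_space (trans_law M p)" "space (trans_law M p) = states M"
proof -
  have "trans_law M p \<in> space (prob_algebra X)"
    using measurable_space[OF trans_law_measurable, of p] assms by (simp add: space_restrict_space)
  then show 1: "sets (trans_law M p) = sets X" and "prob_space (trans_law M p)"
    by (auto simp: space_prob_algebra)
  from sets_eq_imp_space_eq[OF 1] show "space (trans_law M p) = states M"
    by (simp add: space_X)
qed

lemma next_state_measurable [measurable]: "next_state M \<in> X \<Otimes>\<^sub>M A \<rightarrow>\<^sub>M prob_algebra X"
  unfolding next_state_def using K_XA
  by (intro measurable_If_restrict_space_iff[THEN iffD2])
     (auto intro!: measurable_compose[OF restrict_XA_K trans_law_measurable] measurable_restrict_space1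
       measurable_compose[OF measurable_fst measurable_return_prob_space])

lemma measurable_on_K:
  assumes "h \<in> borel_measurable (restrict_space borel K)"
  shows "(\<lambda>p. if p \<in> K then h p else (0::ennreal)) \<in> borel_measurable (X \<Otimes>\<^sub>M A)"
  using K_XA
  by (intro measurable_If_restrict_space_iff[THEN iffD2])
     (auto intro!: measurable_compose[OF restrict_XA_K assms])

lemma trans_nn_integral_measurable:
  assumes "u \<in> borel_measurable X"
  shows "(\<lambda>p. \<integral>\<^sup>+y. u y \<partial>trans_law M p) \<in> borel_measurable (restrict_space borel K)"
  by (rule measurable_compose[OF measurable_prob_algebraD[OF trans_law_measurable]
      nn_integral_measurable_subprob_algebra[OF assms]])

text \<open>The cost as an extended nonnegative real, extended by 0 outside \<open>K\<close>.\<close>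

definition stage_cost :: "'x \<times> 'a \<Rightarrow> ennreal" where
  "stage_cost p = (if p \<in> K then ennreal (cost M p) else 0)"

lemma stage_cost_measurable [measurable]: "stage_cost \<in> borel_measurable (X \<Otimes>\<^sub>M A)"
proof -
  have "cost M \<in> borel_measurable (restrict_space borel K)"
    using model by (simp add: is_control_model_def)
  then have "(\<lambda>p. ennreal (cost M p)) \<in> borel_measurable (restrict_space borel K)" by simp
  from measurable_on_K[OF this] show ?thesis
    by (simp add: stage_cost_def[abs_def])
qed

end

text \<open>A policy and an initial state outside the target.\<close>

locale controlled_process = control M
  for M :: "('x::polish_space, 'a::polish_space, 'm) control_model_scheme" +
  fixes \<phi> :: "nat \<Rightarrow> 'x \<Rightarrow> 'a measure" and x :: 'x
  assumes policy: "\<phi> \<in> policies M" and start: "x \<in> S"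
begin

sublocale Ionescu_Tulcea "step_kernel M \<phi> x" "\<lambda>_. X \<Otimes>\<^sub>M A"
  by (rule Ionescu_Tulcea_step_kernel[OF model policy S_states[OF start]])

lemma path_measure_eq: "path_measure M \<phi> x = PF.lim"
  by (simp add: path_measure_def)

lemma space_path: "space (path_measure M \<phi> x) = space (PiM UNIV (\<lambda>_. X \<Otimes>\<^sub>M A))"
  by (simp add: path_measure_eq)

lemma path_in_states: "\<omega> \<in> space (path_measure M \<phi> x) \<Longrightarrow> \<omega> i \<in> space (X \<Otimes>\<^sub>M A)"
  by (auto simp: space_path space_PiM)

lemma emeasure_path_space: "emeasure (path_measure M \<phi> x) (space (path_measure M \<phi> x)) = 1"
proof -
  have u: "(\<lambda>x. undefined) \<in> space (PiM {0..<0::nat} (\<lambda>_. X \<Otimes>\<^sub>M A))"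
    by (simp add: space_PiM)
  have "emeasure PF.lim (space PF.lim) = (\<integral>\<^sup>+\<omega>. 1 \<partial>PF.lim)" by simp
  also have "\<dots> = (\<integral>\<^sup>+\<omega>. 1 \<partial>C 0 0 (\<lambda>x. undefined))"
    by (rule nn_integral_lim_restrict) simp
  also have "\<dots> = 1"
    using prob_space.emeasure_space_1[OF prob_space_C[OF u, of 0]] by simp
  finally show ?thesis by (simp add: path_measure_eq)
qed

lemma policy_measurable [measurable]: "\<phi> t \<in> X \<rightarrow>\<^sub>M prob_algebra A"
  using policy by (simp add: policies_def)

lemma policy_prob:
  assumes "y \<in> states M"
  shows "sets (\<phi> t y) = sets A" "prob_space (\<phi> t y)" "space (\<phi> t y) = actions M"
proof -
  have "\<phi> t y \<in> space (prob_algebra A)"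
    using measurable_space[OF policy_measurable, of y t] assms by (simp add: space_X)
  then show 1: "sets (\<phi> t y) = sets A" and "prob_space (\<phi> t y)"
    by (auto simp: space_prob_algebra)
  from sets_eq_imp_space_eq[OF 1] show "space (\<phi> t y) = actions M"
    by (simp add: space_A)
qed

lemma policy_feasible:
  assumes "y \<in> S"
  shows "AE a in \<phi> t y. (y, a) \<in> K"
proof -
  interpret prob_space "\<phi> t y" by (rule policy_prob[OF S_states[OF assms]])
  have "feasible M y \<in> sets borel"
    using model S_states[OF assms] by (auto simp: is_control_model_def)
  then have "feasible M y \<in> events"
    using policy_prob(1)[OF S_states[OF assms]] feasible_sub[OF S_states[OF assms]] borel_sets(2)
    by (simp add: action_space_def sets_restrict_space_iff)
  moreover have "emeasure (\<phi> t y) (feasible M y) = 1"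
    using policy assms by (simp add: policies_def)
  ultimately have "AE a in \<phi> t y. a \<in> feasible M y"
    by (intro AE_prob_1) (simp add: emeasure_eq_measure)
  then show ?thesis using assms by (simp add: K_iff)
qed

text \<open>\<open>act_average t h y\<close> is the integral of \<open>h (y, a)\<close> when the action \<open>a\<close> is chosen by the policy at time \<open>t\<close>
  in state \<open>y\<close>.\<close>

definition act_average :: "nat \<Rightarrow> ('x \<times> 'a \<Rightarrow> ennreal) \<Rightarrow> 'x \<Rightarrow> ennreal" where
  "act_average t h y = (\<integral>\<^sup>+a. h (y, a) \<partial>\<phi> t y)"

lemma act_average_measurable [measurable]:
  assumes [measurable]: "h \<in> borel_measurable (X \<Otimes>\<^sub>M A)"
  shows "act_average t h \<in> borel_measurable X"
  unfolding act_average_def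
  by (rule nn_integral_measurable_subprob_algebra2[of _ _ A])
     (auto intro: measurable_prob_algebraD[OF policy_measurable])

lemma act_average_mono:
  assumes "y \<in> S" "\<And>p. p \<in> K \<Longrightarrow> h p \<le> h' p"
  shows "act_average t h y \<le> act_average t h' y"
  unfolding act_average_def
proof (rule nn_integral_mono_AE)
  show "AE a in \<phi> t y. h (y, a) \<le> h' (y, a)"
    using policy_feasible[OF assms(1), of t] by eventually_elim (rule assms(2))
qed

lemma nn_integral_append_action:
  assumes N: "sets N = sets X" and h: "h \<in> borel_measurable (X \<Otimes>\<^sub>M A)"
  shows "(\<integral>\<^sup>+p. h p \<partial>(N \<bind> (\<lambda>y. \<phi> t y \<bind> (\<lambda>a. return (X \<Otimes>\<^sub>M A) (y, a))))) = (\<integral>\<^sup>+y. act_average t h y \<partial>N)"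
proof -
  have k: "(\<lambda>y. \<phi> t y \<bind> (\<lambda>a. return (X \<Otimes>\<^sub>M A) (y, a))) \<in> X \<rightarrow>\<^sub>M subprob_algebra (X \<Otimes>\<^sub>M A)"
    by (rule measurable_prob_algebraD) measurable
  then have "(\<lambda>y. \<phi> t y \<bind> (\<lambda>a. return (X \<Otimes>\<^sub>M A) (y, a))) \<in> N \<rightarrow>\<^sub>M subprob_algebra (X \<Otimes>\<^sub>M A)"
    using N by (simp cong: measurable_cong_sets)
  from nn_integral_bind[OF h this]
  have "(\<integral>\<^sup>+p. h p \<partial>(N \<bind> (\<lambda>y. \<phi> t y \<bind> (\<lambda>a. return (X \<Otimes>\<^sub>M A) (y, a)))))
      = (\<integral>\<^sup>+y. \<integral>\<^sup>+p. h p \<partial>(\<phi> t y \<bind> (\<lambda>a. return (X \<Otimes>\<^sub>M A) (y, a))) \<partial>N)" .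
  also have "\<dots> = (\<integral>\<^sup>+y. act_average t h y \<partial>N)"
  proof (rule nn_integral_cong)
    fix y assume "y \<in> space N"
    then have y: "y \<in> states M" using sets_eq_imp_space_eq[OF N] by (simp add: space_X)
    have "(\<lambda>a. (y, a)) \<in> A \<rightarrow>\<^sub>M X \<Otimes>\<^sub>M A"
      using y by (intro measurable_Pair1') (simp add: space_X)
    then have "(\<lambda>a. return (X \<Otimes>\<^sub>M A) (y, a)) \<in> A \<rightarrow>\<^sub>M subprob_algebra (X \<Otimes>\<^sub>M A)"
      by (rule measurable_compose) (rule return_measurable)
    then have "(\<lambda>a. return (X \<Otimes>\<^sub>M A) (y, a)) \<in> \<phi> t y \<rightarrow>\<^sub>M subprob_algebra (X \<Otimes>\<^sub>M A)"
      using policy_prob(1)[OF y, of t] by (simp cong: measurable_cong_sets)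
    from nn_integral_bind[OF h this]
    have "(\<integral>\<^sup>+p. h p \<partial>(\<phi> t y \<bind> (\<lambda>a. return (X \<Otimes>\<^sub>M A) (y, a))))
        = (\<integral>\<^sup>+a. \<integral>\<^sup>+p. h p \<partial>return (X \<Otimes>\<^sub>M A) (y, a) \<partial>\<phi> t y)" .
    also have "\<dots> = act_average t h y"
      unfolding act_average_def using y policy_prob(3)[OF y, of t]
      by (intro nn_integral_cong nn_integral_return h) (simp add: space_pair_measure space_X space_A)
    finally show "(\<integral>\<^sup>+p. h p \<partial>(\<phi> t y \<bind> (\<lambda>a. return (X \<Otimes>\<^sub>M A) (y, a)))) = act_average t h y" .
  qed
  finally show ?thesis .
qed

text \<open>The target has not been reached up to and including time \<open>n\<close>, that is, \<open>n < \<tau>\<close>.\<close>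

definition alive :: "nat \<Rightarrow> (nat \<Rightarrow> 'x \<times> 'a) \<Rightarrow> bool" where
  "alive n \<omega> \<longleftrightarrow> (\<forall>i\<le>n. fst (\<omega> i) \<in> S)"

text \<open>\<open>stage_mean n h\<close> is the expectation of \<open>h (x\<^sub>n, a\<^sub>n)\<close> on the event \<open>n < \<tau>\<close>. The next lemmas compute it by
  recursion on \<open>n\<close>, so that shifted processes are never needed.\<close>

definition stage_mean :: "nat \<Rightarrow> ('x \<times> 'a \<Rightarrow> ennreal) \<Rightarrow> ennreal" where
  "stage_mean n h = (\<integral>\<^sup>+\<omega>. (if alive n \<omega> then h (\<omega> n) else 0) \<partial>path_measure M \<phi> x)"

lemma alive_measurable [measurable]:
  assumes "\<And>i. i \<le> n \<Longrightarrow> i \<in> I"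
  shows "Measurable.pred (PiM I (\<lambda>_. X \<Otimes>\<^sub>M A)) (alive n)"
proof -
  have "(\<lambda>\<omega>. fst (\<omega> i)) \<in> PiM I (\<lambda>_. X \<Otimes>\<^sub>M A) \<rightarrow>\<^sub>M X" if "i \<le> n" for i
    using measurable_compose[OF measurable_component_singleton[OF assms[OF that]] measurable_fst] .
  then have "Measurable.pred (PiM I (\<lambda>_. X \<Otimes>\<^sub>M A)) (\<lambda>\<omega>. fst (\<omega> i) \<in> S)" if "i \<in> {..n}" for i
    using that by (intro pred_sets2[OF S_X]) simp
  then have "Measurable.pred (PiM I (\<lambda>_. X \<Otimes>\<^sub>M A)) (\<lambda>\<omega>. \<forall>i\<in>{..n}. fst (\<omega> i) \<in> S)"
    by (rule pred_intros_countable_bounded)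
  moreover have "alive n = (\<lambda>\<omega>. \<forall>i\<in>{..n}. fst (\<omega> i) \<in> S)"
    by (auto simp: alive_def fun_eq_iff)
  ultimately show ?thesis by (simp only:)
qed

lemma alive_fun_measurable:
  assumes h: "h \<in> borel_measurable (X \<Otimes>\<^sub>M A)" and I: "\<And>i. i \<le> n \<Longrightarrow> i \<in> I"
  shows "(\<lambda>\<omega>. if alive n \<omega> then h (\<omega> n) else (0::ennreal)) \<in> borel_measurable (PiM I (\<lambda>_. X \<Otimes>\<^sub>M A))"
  using alive_measurable[OF I] measurable_compose[OF measurable_component_singleton[of n I] h] I
  by (intro measurable_If) (auto simp: pred_def)

lemma stage_mean_step:
  assumes h: "h \<in> borel_measurable (X \<Otimes>\<^sub>M A)"
  shows "stage_mean n h = (\<integral>\<^sup>+\<omega>. (\<integral>\<^sup>+p. (if alive n ((restrict \<omega> {0..<n})(n := p)) then h p else 0)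
      \<partial>step_kernel M \<phi> x n (restrict \<omega> {0..<n})) \<partial>path_measure M \<phi> x)"
proof -
  let ?f = "\<lambda>\<omega>. if alive n \<omega> then h (\<omega> n) else 0"
  have "alive n (restrict \<omega> {0..<Suc n}) = alive n \<omega>" for \<omega>
    by (auto simp: alive_def)
  then have "?f (restrict \<omega> {0..<Suc n}) = ?f \<omega>" for \<omega>
    by simp
  then have "stage_mean n h = (\<integral>\<^sup>+\<omega>. ?f (restrict \<omega> {0..<Suc n}) \<partial>PF.lim)"
    by (simp add: stage_mean_def path_measure_eq)
  also have "\<dots> = (\<integral>\<^sup>+\<omega>. (\<integral>\<^sup>+y. ?f ((restrict \<omega> {0..<n})(n := y))
      \<partial>step_kernel M \<phi> x n (restrict \<omega> {0..<n})) \<partial>PF.lim)"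
    by (intro nn_integral_lim_step alive_fun_measurable h) auto
  finally show ?thesis unfolding path_measure_eq fun_upd_same .
qed

lemma stage_mean_0:
  assumes h: "h \<in> borel_measurable (X \<Otimes>\<^sub>M A)"
  shows "stage_mean 0 h = act_average 0 h x"
proof -
  let ?h = "\<lambda>p. if fst p \<in> S then h p else 0"
  have h': "?h \<in> borel_measurable (X \<Otimes>\<^sub>M A)"
    using h by measurable
  have "stage_mean 0 h = (\<integral>\<^sup>+\<omega>. (\<integral>\<^sup>+p. ?h p \<partial>step_kernel M \<phi> x 0 (restrict \<omega> {0..<0})) \<partial>path_measure M \<phi> x)"
    unfolding stage_mean_step[OF h] by (simp add: alive_def)
  also have "\<dots> = (\<integral>\<^sup>+\<omega>. act_average 0 ?h x \<partial>path_measure M \<phi> x)"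
    unfolding step_kernel_def using S_states[OF start]
    by (simp add: nn_integral_append_action[OF _ h'] nn_integral_return act_average_measurable[OF h'] space_X)
  also have "\<dots> = act_average 0 ?h x"
    by (simp add: emeasure_path_space)
  also have "\<dots> = act_average 0 h x"
    using start by (simp add: act_average_def)
  finally show ?thesis .
qed

text \<open>This version still contains the transition kernel of the definition, which is modified outside \<open>K\<close>;
  that the pair at time \<open>n\<close> is almost surely in \<open>K\<close> on \<open>n < \<tau>\<close> follows from it.\<close>

lemma stage_mean_Suc':
  assumes h: "h \<in> borel_measurable (X \<Otimes>\<^sub>M A)"
  shows "stage_mean (Suc n) h =
    stage_mean n (\<lambda>p. \<integral>\<^sup>+y. (if y \<in> S then act_average (Suc n) h y else 0) \<partial>next_state M p)"
proof -
  let ?h = "\<lambda>p. if fst p \<in> S then h p else 0"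
  have h': "?h \<in> borel_measurable (X \<Otimes>\<^sub>M A)"
    using h by measurable
  show ?thesis
    unfolding stage_mean_step[OF h, of "Suc n"] stage_mean_def[of n]
  proof (rule nn_integral_cong)
    fix \<omega> assume \<omega>: "\<omega> \<in> space (path_measure M \<phi> x)"
    have al: "alive (Suc n) ((restrict \<omega> {0..<Suc n})(Suc n := p)) \<longleftrightarrow> alive n \<omega> \<and> fst p \<in> S" for p
      by (auto simp: alive_def le_Suc_eq)
    have nx: "sets (next_state M (\<omega> n)) = sets X"
      using measurable_space[OF next_state_measurable path_in_states[OF \<omega>, of n]]
      by (simp add: space_prob_algebra)
    have "(\<integral>\<^sup>+p. (if alive (Suc n) ((restrict \<omega> {0..<Suc n})(Suc n := p)) then h p else 0)
        \<partial>step_kernel M \<phi> x (Suc n) (restrict \<omega> {0..<Suc n}))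
      = (if alive n \<omega> then (\<integral>\<^sup>+p. ?h p \<partial>step_kernel M \<phi> x (Suc n) (restrict \<omega> {0..<Suc n})) else 0)"
      unfolding al by (cases "alive n \<omega>") simp_all
    also have "(\<integral>\<^sup>+p. ?h p \<partial>step_kernel M \<phi> x (Suc n) (restrict \<omega> {0..<Suc n}))
        = (\<integral>\<^sup>+y. act_average (Suc n) ?h y \<partial>next_state M (\<omega> n))"
      unfolding step_kernel_def by (simp add: nn_integral_append_action[OF nx h'])
    also have "\<dots> = (\<integral>\<^sup>+y. (if y \<in> S then act_average (Suc n) h y else 0) \<partial>next_state M (\<omega> n))"
      by (intro nn_integral_cong) (simp add: act_average_def)
    finally show "(\<integral>\<^sup>+p. (if alive (Suc n) ((restrict \<omega> {0..<Suc n})(Suc n := p)) then h p else 0)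
        \<partial>step_kernel M \<phi> x (Suc n) (restrict \<omega> {0..<Suc n}))
      = (if alive n \<omega> then (\<integral>\<^sup>+y. (if y \<in> S then act_average (Suc n) h y else 0) \<partial>next_state M (\<omega> n)) else 0)" .
  qed
qed

lemma stage_mean_mono_average:
  assumes h: "h \<in> borel_measurable (X \<Otimes>\<^sub>M A)" "h' \<in> borel_measurable (X \<Otimes>\<^sub>M A)"
    and le: "\<And>y. y \<in> S \<Longrightarrow> act_average n h y \<le> act_average n h' y"
  shows "stage_mean n h \<le> stage_mean n h'"
proof (cases n)
  case 0
  then show ?thesis
    using le[OF start] by (simp add: stage_mean_0 h)
next
  case (Suc k)
  show ?thesis
    unfolding Suc unfolding stage_mean_Suc'[OF h(1)] stage_mean_Suc'[OF h(2)] unfolding stage_mean_def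
    using le[unfolded Suc] by (intro nn_integral_mono) (auto intro!: nn_integral_mono)
qed

lemma stage_mean_mono:
  assumes "h \<in> borel_measurable (X \<Otimes>\<^sub>M A)" "h' \<in> borel_measurable (X \<Otimes>\<^sub>M A)"
    and "\<And>p. p \<in> K \<Longrightarrow> h p \<le> h' p"
  shows "stage_mean n h \<le> stage_mean n h'"
  by (intro stage_mean_mono_average act_average_mono assms)

lemma stage_mean_cong:
  assumes "h \<in> borel_measurable (X \<Otimes>\<^sub>M A)" "h' \<in> borel_measurable (X \<Otimes>\<^sub>M A)"
    and "\<And>p. p \<in> K \<Longrightarrow> h p = h' p"
  shows "stage_mean n h = stage_mean n h'"
  by (intro antisym stage_mean_mono assms(1,2)) (simp_all add: assms(3))

lemma stage_mean_Suc:
  assumes h: "h \<in> borel_measurable (X \<Otimes>\<^sub>M A)"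
  shows "stage_mean (Suc n) h =
    stage_mean n (\<lambda>p. if p \<in> K then \<integral>\<^sup>+y. (if y \<in> S then act_average (Suc n) h y else 0) \<partial>trans_law M p else 0)"
proof -
  let ?u = "\<lambda>y. if y \<in> S then act_average (Suc n) h y else 0"
  have u: "?u \<in> borel_measurable X" using h by measurable
  show ?thesis
    unfolding stage_mean_Suc'[OF h]
  proof (rule stage_mean_cong)
    show "(\<lambda>p. \<integral>\<^sup>+y. ?u y \<partial>next_state M p) \<in> borel_measurable (X \<Otimes>\<^sub>M A)"
      by (rule measurable_compose[OF measurable_prob_algebraD[OF next_state_measurable]
          nn_integral_measurable_subprob_algebra[OF u]])
    show "(\<lambda>p. if p \<in> K then \<integral>\<^sup>+y. ?u y \<partial>trans_law M p else 0) \<in> borel_measurable (X \<Otimes>\<^sub>M A)"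
      by (rule measurable_on_K[OF trans_nn_integral_measurable[OF u]])
  qed (simp add: next_state_def)
qed

lemma stage_mean_add:
  assumes "h \<in> borel_measurable (X \<Otimes>\<^sub>M A)" "h' \<in> borel_measurable (X \<Otimes>\<^sub>M A)"
  shows "stage_mean n (\<lambda>p. h p + h' p) = stage_mean n h + stage_mean n h'"
proof -
  have "stage_mean n (\<lambda>p. h p + h' p) = (\<integral>\<^sup>+\<omega>. (if alive n \<omega> then h (\<omega> n) else 0) +
      (if alive n \<omega> then h' (\<omega> n) else 0) \<partial>path_measure M \<phi> x)"
    unfolding stage_mean_def by (intro nn_integral_cong) simp
  also have "\<dots> = stage_mean n h + stage_mean n h'"
    unfolding stage_mean_def
    by (intro nn_integral_add) (simp_all add: path_measure_eq alive_fun_measurable assms cong: measurable_cong_sets)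
  finally show ?thesis .
qed

lemma stage_mean_cmult:
  assumes "h \<in> borel_measurable (X \<Otimes>\<^sub>M A)"
  shows "stage_mean n (\<lambda>p. c * h p) = c * stage_mean n h"
proof -
  have "stage_mean n (\<lambda>p. c * h p) = (\<integral>\<^sup>+\<omega>. c * (if alive n \<omega> then h (\<omega> n) else 0) \<partial>path_measure M \<phi> x)"
    unfolding stage_mean_def by (intro nn_integral_cong) simp
  also have "\<dots> = c * stage_mean n h"
    unfolding stage_mean_def
    by (intro nn_integral_cmult) (simp_all add: path_measure_eq alive_fun_measurable assms cong: measurable_cong_sets)
  finally show ?thesis .
qed

lemma AE_active: "AE \<omega> in path_measure M \<phi> x. \<forall>n. alive n \<omega> \<longrightarrow> \<omega> n \<in> K"
  unfolding AE_all_countable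
proof
  fix n
  let ?h = "\<lambda>p. if p \<in> K then 0 else (1::ennreal)"
  have h: "?h \<in> borel_measurable (X \<Otimes>\<^sub>M A)" by measurable
  have "stage_mean n ?h = stage_mean n (\<lambda>_. 0)"
    by (intro stage_mean_cong h) auto
  then have "(\<integral>\<^sup>+\<omega>. (if alive n \<omega> then ?h (\<omega> n) else 0) \<partial>path_measure M \<phi> x) = 0"
    by (simp add: stage_mean_def)
  moreover have "(\<lambda>\<omega>. if alive n \<omega> then ?h (\<omega> n) else 0) \<in> borel_measurable (path_measure M \<phi> x)"
    using alive_fun_measurable[OF h, of n UNIV] by (simp add: path_measure_eq cong: measurable_cong_sets)
  ultimately have "AE \<omega> in path_measure M \<phi> x. (if alive n \<omega> then ?h (\<omega> n) else 0) = 0"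
    by (simp add: nn_integral_0_iff_AE)
  then show "AE \<omega> in path_measure M \<phi> x. alive n \<omega> \<longrightarrow> \<omega> n \<in> K"
    by eventually_elim (auto split: if_splits)
qed

lemma less_hitting_time_iff:
  assumes "\<omega> \<in> space (path_measure M \<phi> x)"
  shows "enat n < hitting_time M \<omega> \<longleftrightarrow> alive n \<omega>"
proof -
  have "fst (\<omega> i) \<in> states M" for i
    using path_in_states[OF assms, of i] by (auto simp: space_pair_measure space_X)
  then have al: "alive n \<omega> \<longleftrightarrow> (\<forall>i\<le>n. fst (\<omega> i) \<notin> target M)"
    by (auto simp: alive_def non_target_def)
  show ?thesis
  proof
    assume *: "enat n < hitting_time M \<omega>"
    have "fst (\<omega> i) \<notin> target M" if "i \<le> n" for i
    proof
      assume "fst (\<omega> i) \<in> target M"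
      then have "hitting_time M \<omega> \<le> enat i"
        unfolding hitting_time_def by (intro INF_lower) simp
      also have "\<dots> \<le> enat n" using that by simp
      finally show False using * by simp
    qed
    then show "alive n \<omega>" by (simp add: al)
  next
    assume "alive n \<omega>"
    then have "enat (Suc n) \<le> hitting_time M \<omega>"
      unfolding hitting_time_def al by (intro INF_greatest) (auto simp: not_less_eq_eq[symmetric])
    then show "enat n < hitting_time M \<omega>"
      by (rule order.strict_trans2[rotated]) simp
  qed
qed

lemma expected_cost_eq:
  assumes nonneg: "\<And>p. p \<in> K \<Longrightarrow> 0 \<le> cost M p"
  shows "expected_cost M \<phi> x = enn2ereal (\<Sum>i. ennreal (discount M ^ i) * stage_mean i stage_cost)"
proof -
  let ?P = "path_measure M \<phi> x"
  let ?c = "\<lambda>i \<omega>. ennreal (discount M ^ i) * (if alive i \<omega> then stage_cost (\<omega> i) else 0)"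
  have disc: "0 \<le> discount M ^ i" for i
    using model by (simp add: is_control_model_def)
  have "AE \<omega> in ?P. total_cost M \<omega> = enn2ereal (\<Sum>i. ?c i \<omega>)"
    using AE_active AE_space
  proof eventually_elim
    case (elim \<omega>)
    have "(if enat i < hitting_time M \<omega> then ereal (discount M ^ i * cost M (\<omega> i)) else 0) = enn2ereal (?c i \<omega>)" for i
    proof (cases "alive i \<omega>")
      case True
      then have "\<omega> i \<in> K" using elim(1) by blast
      then have "?c i \<omega> = ennreal (discount M ^ i * cost M (\<omega> i))"
        using True by (simp add: stage_cost_def ennreal_mult disc nonneg)
      then show ?thesis
        using True less_hitting_time_iff[OF elim(2)] \<open>\<omega> i \<in> K\<close> by (simp add: disc nonneg)
    next
      case False
      then show ?thesis using less_hitting_time_iff[OF elim(2)] by (simp add: zero_ennreal.rep_eq)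
    qed
    then show ?case
      unfolding total_cost_def by simp
  qed
  then have AE: "AE \<omega> in ?P. e2ennreal (total_cost M \<omega>) = (\<Sum>i. ?c i \<omega>)"
    and AE': "AE \<omega> in ?P. e2ennreal (- total_cost M \<omega>) = 0"
    by (eventually_elim, simp add: e2ennreal_neg)+
  have 1: "(\<integral>\<^sup>+\<omega>. e2ennreal (total_cost M \<omega>) \<partial>?P) = (\<integral>\<^sup>+\<omega>. (\<Sum>i. ?c i \<omega>) \<partial>?P)"
    and 2: "(\<integral>\<^sup>+\<omega>. e2ennreal (- total_cost M \<omega>) \<partial>?P) = (\<integral>\<^sup>+\<omega>. 0 \<partial>?P)"
    by (rule nn_integral_cong_AE[OF AE], rule nn_integral_cong_AE[OF AE'])
  have m: "(\<lambda>\<omega>. if alive i \<omega> then stage_cost (\<omega> i) else 0) \<in> borel_measurable ?P" for i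
    using alive_fun_measurable[OF stage_cost_measurable, of i UNIV]
    by (simp add: path_measure_eq cong: measurable_cong_sets)
  have "(\<integral>\<^sup>+\<omega>. (\<Sum>i. ?c i \<omega>) \<partial>?P) = (\<Sum>i. \<integral>\<^sup>+\<omega>. ?c i \<omega> \<partial>?P)"
    using m by (intro nn_integral_suminf) auto
  also have "\<dots> = (\<Sum>i. ennreal (discount M ^ i) * stage_mean i stage_cost)"
    using m by (simp add: nn_integral_cmult stage_mean_def)
  finally show ?thesis
    unfolding expected_cost_def ext_integral_def 1 2 by (simp add: zero_ennreal.rep_eq)
qed

end

section \<open>The optimality operator\<close>

lemma ennreal_le_of_geometric_error:
  fixes y z :: ennreal
  assumes "\<And>n. z \<le> y + ennreal (c * q ^ n)" "0 \<le> q" "q < 1"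
  shows "z \<le> y"
proof -
  have "(\<lambda>n. c * q ^ n) \<longlonglongrightarrow> c * 0"
    using assms by (intro tendsto_intros LIMSEQ_power_zero) auto
  then have "(\<lambda>n. y + ennreal (c * q ^ n)) \<longlonglongrightarrow> y + ennreal (c * 0)"
    by (intro tendsto_add tendsto_const tendsto_ennrealI)
  then have "z \<le> y + ennreal (c * 0)"
    by (rule LIMSEQ_le_const) (use assms in auto)
  then show ?thesis by simp
qed

context control
begin

text \<open>The measurable space of states outside the target.\<close>

abbreviation "NT \<equiv> restrict_space borel S"

lemma extend_by_zero_measurable:
  assumes "u \<in> borel_measurable NT"
  shows "(\<lambda>y. if y \<in> S then u y else (0::ennreal)) \<in> borel_measurable X"
proof -
  have "(\<lambda>y. y) \<in> restrict_space X S \<rightarrow>\<^sub>M NT"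
    by (intro measurable_restrict_space2 measurable_restrict_space1)
       (auto simp: state_space_def space_restrict_space intro!: measurable_restrict_space1)
  then show ?thesis
    using S_X by (intro measurable_If_restrict_space_iff[THEN iffD2])
      (auto intro!: measurable_compose[OF _ assms])
qed

text \<open>The integral of \<open>u\<close> over the next state, as far as it lies outside the target; together
  with \<open>q_value\<close> and \<open>bellman_op\<close> it expresses the optimality equation in extended nonnegative reals,
  where all integrals exist and no subtraction is needed.\<close>

definition killed_integral :: "('x \<Rightarrow> ennreal) \<Rightarrow> 'x \<times> 'a \<Rightarrow> ennreal" where
  "killed_integral u p = (\<integral>\<^sup>+y. (if y \<in> S then u y else 0) \<partial>trans_law M p)"

text \<open>The cost of one stage plus the discounted expected value of \<open>u\<close> after it.\<close>

definition q_value :: "('x \<Rightarrow> ennreal) \<Rightarrow> 'x \<times> 'a \<Rightarrow> ennreal" where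
  "q_value u p = ennreal (cost M p) + ennreal (discount M) * killed_integral u p"

text \<open>An infimum; \<open>bellman_op_attained\<close> below shows that it is a minimum.\<close>

definition bellman_op :: "('x \<Rightarrow> ennreal) \<Rightarrow> 'x \<Rightarrow> ennreal" where
  "bellman_op u x = (INF a\<in>feasible M x. q_value u (x, a))"

lemma discount_bounds: "0 < discount M" "discount M < 1"
  using model by (auto simp: is_control_model_def)

lemma killed_integral_mono: "(\<And>y. y \<in> S \<Longrightarrow> u y \<le> u' y) \<Longrightarrow> killed_integral u p \<le> killed_integral u' p"
  unfolding killed_integral_def by (intro nn_integral_mono) auto

lemma q_value_mono: "(\<And>y. y \<in> S \<Longrightarrow> u y \<le> u' y) \<Longrightarrow> q_value u p \<le> q_value u' p"
  unfolding q_value_def by (intro add_left_mono mult_left_mono killed_integral_mono) auto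

lemma bellman_op_mono: "(\<And>y. y \<in> S \<Longrightarrow> u y \<le> u' y) \<Longrightarrow> bellman_op u x \<le> bellman_op u' x"
  unfolding bellman_op_def by (intro INF_mono) (auto intro: q_value_mono)

lemma killed_integral_measurable:
  assumes "u \<in> borel_measurable NT"
  shows "killed_integral u \<in> borel_measurable (restrict_space borel K)"
  unfolding killed_integral_def[abs_def]
  by (intro trans_nn_integral_measurable extend_by_zero_measurable assms)

lemma q_value_measurable:
  assumes "u \<in> borel_measurable NT"
  shows "q_value u \<in> borel_measurable (restrict_space borel K)"
proof -
  have "cost M \<in> borel_measurable (restrict_space borel K)"
    using model by (simp add: is_control_model_def)
  then show ?thesis
    unfolding q_value_def[abs_def] using killed_integral_measurable[OF assms] by measurable
qed

lemma killed_integral_add: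
  assumes "u \<in> borel_measurable NT" "u' \<in> borel_measurable NT" "p \<in> K"
  shows "killed_integral (\<lambda>y. u y + c * u' y) p = killed_integral u p + c * killed_integral u' p"
proof -
  let ?u = "\<lambda>y. if y \<in> S then u y else 0" and ?u' = "\<lambda>y. if y \<in> S then u' y else 0"
  have m: "?u \<in> borel_measurable (trans_law M p)" "?u' \<in> borel_measurable (trans_law M p)"
    using extend_by_zero_measurable[OF assms(1)] extend_by_zero_measurable[OF assms(2)]
      trans_law_prob(1)[OF assms(3)] by (simp_all cong: measurable_cong_sets)
  have "killed_integral (\<lambda>y. u y + c * u' y) p = (\<integral>\<^sup>+y. ?u y + c * ?u' y \<partial>trans_law M p)"
    unfolding killed_integral_def by (intro nn_integral_cong) simp
  also have "\<dots> = killed_integral u p + c * killed_integral u' p"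
    unfolding killed_integral_def using m by (simp add: nn_integral_add nn_integral_cmult)
  finally show ?thesis .
qed

lemma trans_integral_eq:
  assumes "\<And>y. y \<in> S \<Longrightarrow> \<xi> y = enn2ereal (u y)"
  shows "trans_integral M \<xi> p = enn2ereal (killed_integral u p)"
proof -
  have "e2ennreal (if y \<in> S then \<xi> y else 0) = (if y \<in> S then u y else 0)"
    and "e2ennreal (- (if y \<in> S then \<xi> y else 0)) = 0" for y
    using assms[of y] by (auto simp: e2ennreal_neg)
  then show ?thesis
    unfolding trans_integral_def ext_integral_def killed_integral_def
    by (simp add: zero_ennreal.rep_eq)
qed

lemma bellman_eq:
  assumes "\<And>y. y \<in> S \<Longrightarrow> \<xi> y = enn2ereal (u y)" "0 \<le> cost M (x, a)"
  shows "bellman M \<xi> x a = enn2ereal (q_value u (x, a))"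
proof -
  have "trans_integral M \<xi> (x, a) = enn2ereal (killed_integral u (x, a))"
    by (rule trans_integral_eq) (rule assms(1))
  then show ?thesis
    unfolding bellman_def q_value_def
    using assms(2) discount_bounds(1) by (simp add: plus_ennreal.rep_eq times_ennreal.rep_eq)
qed

end

text \<open>Compact action sets, a nonnegative lower semicontinuous cost, and a strongly Feller transition law.\<close>

locale regular_control = control M
  for M :: "('x::polish_space, 'a::polish_space, 'm) control_model_scheme" +
  assumes compact_actions: "\<And>x. x \<in> states M \<Longrightarrow> compact (feasible M x)"
    and cost_lsc: "seq_lsc_on (active_pairs M) (cost M)"
    and cost_nonneg: "\<And>p. p \<in> active_pairs M \<Longrightarrow> 0 \<le> cost M p"
    and feller: "strongly_Feller M"
begin

text \<open>For a bounded function the strong Feller property applies directly. An unbounded nonnegative function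
  is the supremum of its truncations, so that its integral is lower semicontinuous in the action.\<close>

lemma truncated_killed_integral_continuous:
  fixes m :: nat
  assumes u: "u \<in> borel_measurable NT"
  obtains \<kappa> where "\<And>p. p \<in> K \<Longrightarrow> killed_integral (\<lambda>y. min (u y) (of_nat m)) p = ennreal (\<kappa> p)"
    "\<And>p. 0 \<le> \<kappa> p" "continuous_on K \<kappa>"
proof -
  define g where "g y = (if y \<in> S then enn2real (min (u y) (of_nat m)) else 0)" for y
  have fin: "min (u y) (of_nat m) < top" for y
    by (simp add: min_less_iff_disj of_nat_less_top)
  have g: "ennreal (g y) = (if y \<in> S then min (u y) (of_nat m) else 0)" for y
    using fin by (simp add: g_def)
  have g_bound: "0 \<le> g y" "g y \<le> m" for y
  proof -
    show "0 \<le> g y" by (simp add: g_def)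
    have "ennreal (g y) \<le> ennreal (real m)" unfolding g by (simp add: ennreal_of_nat_eq_real_of_nat)
    then show "g y \<le> m" by simp
  qed
  have "(\<lambda>y. min (u y) (of_nat m)) \<in> borel_measurable NT" using u by measurable
  from extend_by_zero_measurable[OF this]
  have "(\<lambda>y. enn2real (if y \<in> S then min (u y) (of_nat m) else 0)) \<in> borel_measurable X" by measurable
  moreover have "(\<lambda>y. enn2real (if y \<in> S then min (u y) (of_nat m) else 0)) = g"
    by (auto simp: g_def)
  ultimately have gm: "g \<in> borel_measurable X" by simp
  have "bounded (g ` states M)"
    unfolding bounded_iff using g_bound by (intro exI[of _ "real m"]) auto
  then have cont: "continuous_on K (\<lambda>p. \<integral>y. g y \<partial>trans_law M p)"
    using feller gm unfolding strongly_Feller_def by blast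
  have eq: "killed_integral (\<lambda>y. min (u y) (of_nat m)) p = ennreal (\<integral>y. g y \<partial>trans_law M p)" if "p \<in> K" for p
  proof -
    interpret prob_space "trans_law M p" by (rule trans_law_prob[OF that])
    have "g \<in> borel_measurable (trans_law M p)"
      using gm trans_law_prob(1)[OF that] by (simp cong: measurable_cong_sets)
    then have "integrable (trans_law M p) g"
      using g_bound by (intro integrable_const_bound[of _ "real m"]) auto
    then show ?thesis
      unfolding killed_integral_def g[symmetric] using g_bound by (intro nn_integral_eq_integral) auto
  qed
  show ?thesis
  proof (rule that)
    show "0 \<le> (\<integral>y. g y \<partial>trans_law M p)" for p
      using g_bound by (intro integral_nonneg_AE) auto
  qed (fact eq cont)+
qed

lemma killed_integral_SUP_truncated:
  assumes u: "u \<in> borel_measurable NT" and p: "p \<in> K"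
  shows "killed_integral u p = (SUP m. killed_integral (\<lambda>y. min (u y) (of_nat m)) p)"
proof -
  let ?g = "\<lambda>m y. if y \<in> S then min (u y) (of_nat m) else 0"
  have m: "?g m \<in> borel_measurable (trans_law M p)" for m
  proof -
    have "(\<lambda>y. min (u y) (of_nat m)) \<in> borel_measurable NT" using u by measurable
    from extend_by_zero_measurable[OF this] show ?thesis
      using trans_law_prob(1)[OF p] by (simp cong: measurable_cong_sets)
  qed
  have sup: "(SUP m. min c (of_nat m)) = c" for c :: ennreal
  proof -
    have "(SUP m. min c (of_nat m :: ennreal)) = min c (SUP m. of_nat m)"
      by (simp add: inf_min[symmetric] inf_SUP)
    then show ?thesis by (simp add: ennreal_SUP_of_nat_eq_top)
  qed
  have "killed_integral u p = (\<integral>\<^sup>+y. (SUP m. ?g m y) \<partial>trans_law M p)"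
    unfolding killed_integral_def by (intro nn_integral_cong) (simp add: sup)
  also have "\<dots> = (SUP m. \<integral>\<^sup>+y. ?g m y \<partial>trans_law M p)"
    using m by (intro nn_integral_monotone_convergence_SUP)
      (auto simp: incseq_def le_fun_def intro: min.coboundedI2 of_nat_mono)
  finally show ?thesis by (simp add: killed_integral_def)
qed

text \<open>It is enough that each truncated sublevel set is closed: along a convergent sequence of actions the
  truncated integral converges and the cost is lower semicontinuous.\<close>

lemma q_value_sublevel_compact:
  assumes u: "u \<in> borel_measurable NT" and x: "x \<in> S"
  shows "compact {a \<in> feasible M x. q_value u (x, a) \<le> r}"
proof (cases "r = top")
  case True
  then show ?thesis using compact_actions[OF S_states[OF x]] by simp
next
  case False
  then obtain r' where r': "r = ennreal r'" "0 \<le> r'" by (cases r) auto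
  have comp: "compact (feasible M x)"
    by (rule compact_actions[OF S_states[OF x]])
  let ?L = "{a \<in> feasible M x. q_value u (x, a) \<le> r}"
  have "closed ?L"
    unfolding closed_sequential_limits
  proof (intro allI impI, elim conjE)
    fix b a assume b: "\<forall>j. b j \<in> ?L" and lim: "b \<longlonglongrightarrow> a"
    have a: "a \<in> feasible M x"
      using b by (intro closed_sequentially[OF compact_imp_closed[OF comp] _ lim]) auto
    have K: "(x, a) \<in> K" "\<And>j. (x, b j) \<in> K" using a b x by (auto simp: K_iff)
    have limp: "(\<lambda>j. (x, b j)) \<longlonglongrightarrow> (x, a)" by (intro tendsto_intros lim)
    have le: "ennreal (cost M (x, a)) + ennreal (discount M) * killed_integral (\<lambda>y. min (u y) (of_nat m)) (x, a) \<le> r" for m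
    proof -
      obtain \<kappa> where \<kappa>: "\<And>p. p \<in> K \<Longrightarrow> killed_integral (\<lambda>y. min (u y) (of_nat m)) p = ennreal (\<kappa> p)"
        "\<And>p. 0 \<le> \<kappa> p" "continuous_on K \<kappa>"
        using truncated_killed_integral_continuous[OF u] by blast
      have c\<kappa>: "ennreal (cost M p) + ennreal (discount M) * killed_integral (\<lambda>y. min (u y) (of_nat m)) p
          = ennreal (cost M p + discount M * \<kappa> p)" if "p \<in> K" for p
        using that discount_bounds cost_nonneg[OF that] \<kappa>(1)[OF that] \<kappa>(2)[of p]
        by (simp add: ennreal_mult ennreal_plus)
      have "cost M (x, b j) \<le> r' - discount M * \<kappa> (x, b j)" for j
      proof -
        have "ennreal (cost M (x, b j) + discount M * \<kappa> (x, b j)) \<le> q_value u (x, b j)"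
          unfolding c\<kappa>[OF K(2), symmetric] q_value_def
          by (intro add_left_mono mult_left_mono killed_integral_mono) auto
        also have "\<dots> \<le> ennreal r'" using b r' by auto
        finally show ?thesis using r'(2) by simp
      qed
      then have le: "liminf (\<lambda>j. ereal (cost M (x, b j))) \<le> liminf (\<lambda>j. ereal (r' - discount M * \<kappa> (x, b j)))"
        by (intro Liminf_mono always_eventually) simp
      have "ereal (cost M (x, a)) \<le> liminf (\<lambda>j. ereal (cost M (x, b j)))"
        by (rule cost_lsc[unfolded seq_lsc_on_def, rule_format]) (intro conjI allI K limp)
      also note le
      also have "liminf (\<lambda>j. ereal (r' - discount M * \<kappa> (x, b j))) = ereal (r' - discount M * \<kappa> (x, a))"
      proof (intro lim_imp_Liminf tendsto_ereal tendsto_intros)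
        show "(\<lambda>j. \<kappa> (x, b j)) \<longlonglongrightarrow> \<kappa> (x, a)"
          using continuous_on_tendsto_compose[OF \<kappa>(3) limp K(1)] K(2) by simp
      qed simp
      finally have "cost M (x, a) \<le> r' - discount M * \<kappa> (x, a)" by simp
      then show ?thesis unfolding c\<kappa>[OF K(1)] r' by (simp add: ennreal_leI)
    qed
    have "q_value u (x, a) = (SUP m. ennreal (cost M (x, a)) + ennreal (discount M) * killed_integral (\<lambda>y. min (u y) (of_nat m)) (x, a))"
      unfolding q_value_def killed_integral_SUP_truncated[OF u K(1)]
      by (simp add: ennreal_SUP_add_right SUP_mult_left_ennreal)
    also have "\<dots> \<le> r" by (intro SUP_least le)
    finally show "a \<in> ?L" using a by simp
  qed
  then have "compact (feasible M x \<inter> ?L)" by (rule compact_Int_closed[OF comp])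
  moreover have "feasible M x \<inter> ?L = ?L" by auto
  ultimately show ?thesis by simp
qed

lemma bellman_op_attained:
  assumes u: "u \<in> borel_measurable NT" and x: "x \<in> S"
  shows "\<exists>a\<in>feasible M x. q_value u (x, a) = bellman_op u x"
proof -
  obtain a0 where a0: "a0 \<in> feasible M x" using feasible_ne[OF S_states[OF x]] by blast
  let ?L = "\<lambda>r. {a \<in> feasible M x. q_value u (x, a) \<le> r}"
  have "feasible M x \<inter> (\<Inter>r\<in>{bellman_op u x<..}. ?L r) \<noteq> {}"
  proof (rule compact_imp_fip_image)
    show "compact (feasible M x)" by (rule compact_actions[OF S_states[OF x]])
    show "closed (?L r)" for r by (rule compact_imp_closed[OF q_value_sublevel_compact[OF u x]])
    fix I assume I: "finite I" "I \<subseteq> {bellman_op u x<..}"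
    show "feasible M x \<inter> (\<Inter>r\<in>I. ?L r) \<noteq> {}"
    proof (cases "I = {}")
      case True
      then show ?thesis using a0 by auto
    next
      case False
      then have "bellman_op u x < Min I" using I by auto
      then obtain a where a: "a \<in> feasible M x" "q_value u (x, a) < Min I"
        unfolding bellman_op_def INF_less_iff by blast
      then have "a \<in> feasible M x \<inter> (\<Inter>r\<in>I. ?L r)" using I(1) False by (auto intro: less_imp_le less_le_trans)
      then show ?thesis by blast
    qed
  qed
  then obtain a where a: "a \<in> feasible M x" "\<And>r. bellman_op u x < r \<Longrightarrow> q_value u (x, a) \<le> r"
    by auto
  have "q_value u (x, a) \<le> bellman_op u x" by (rule dense_ge) (rule a)
  moreover have "bellman_op u x \<le> q_value u (x, a)" unfolding bellman_op_def by (intro INF_lower a)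
  ultimately show ?thesis using a(1) by (intro bexI[of _ a]) auto
qed

text \<open>The sublevel sets are projections of Borel sets with compact sections. This is where the projection
  theorem is needed, as no regularity of \<open>x \<mapsto> A(x)\<close> is assumed beyond compact values and
  a Borel graph.\<close>

lemma bellman_op_measurable:
  assumes u: "u \<in> borel_measurable NT"
  shows "bellman_op u \<in> borel_measurable NT"
proof (rule borel_measurableI_le)
  fix r
  let ?B = "{p \<in> K. q_value u p \<le> r}"
  have "{p \<in> space (restrict_space borel K). q_value u p \<le> r} \<in> sets (restrict_space borel K)"
    using q_value_measurable[OF u] by measurable
  then have B: "?B \<in> sets borel"
    using K_borel by (simp add: space_restrict_space sets_restrict_space_iff)
  have "compact {a. (x, a) \<in> ?B}" for x
  proof (cases "x \<in> S")
    case True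
    then have "{a. (x, a) \<in> ?B} = {a \<in> feasible M x. q_value u (x, a) \<le> r}" by (auto simp: K_iff)
    then show ?thesis using q_value_sublevel_compact[OF u True] by simp
  next
    case False
    then show ?thesis by (simp add: K_iff)
  qed
  with B have "fst ` ?B \<in> sets borel" by (rule borel_projection_of_compact_sections)
  moreover have "fst ` ?B = {x \<in> S. bellman_op u x \<le> r}"
  proof safe
    fix x a assume xa: "(x, a) \<in> K" "q_value u (x, a) \<le> r"
    then show "fst (x, a) \<in> S" by (simp add: K_iff)
    have "bellman_op u x \<le> q_value u (x, a)" unfolding bellman_op_def using xa by (intro INF_lower) (simp add: K_iff)
    then show "bellman_op u (fst (x, a)) \<le> r" using xa by simp
  next
    fix x assume x: "x \<in> S" "bellman_op u x \<le> r"
    then obtain a where "a \<in> feasible M x" "q_value u (x, a) = bellman_op u x" using bellman_op_attained[OF u] by blast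
    then show "x \<in> fst ` ?B" using x by (intro image_eqI[of _ _ "(x, a)"]) (auto simp: K_iff)
  qed
  ultimately show "{x \<in> space NT. bellman_op u x \<le> r} \<in> sets NT"
    using S_borel by (auto simp: space_restrict_space sets_restrict_space_iff)
qed

lemma bellman_op_selector:
  assumes u: "u \<in> borel_measurable NT"
  shows "\<exists>f \<in> borel_measurable borel. \<forall>x\<in>S. f x \<in> feasible M x \<and> q_value u (x, f x) = bellman_op u x"
proof -
  \<comment> \<open>Over target states the set of minimisers is padded with an arbitrary constant action, so that
    every section is nonempty.\<close>
  define a0 :: 'a where "a0 = undefined"
  let ?B = "{p \<in> K. q_value u p \<le> bellman_op u (fst p)}" and ?C = "(- S) \<times> {a0}"
  have "fst \<in> restrict_space borel K \<rightarrow>\<^sub>M NT"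
    by (intro measurable_restrict_space2 measurable_restrict_space1 borel_measurable_continuous_onI continuous_intros)
       (auto simp: space_restrict_space K_iff)
  from measurable_compose[OF this bellman_op_measurable[OF u]] q_value_measurable[OF u]
  have "{p \<in> space (restrict_space borel K). q_value u p \<le> bellman_op u (fst p)} \<in> sets (restrict_space borel K)"
    by measurable
  then have "?B \<in> sets borel"
    using K_borel by (simp add: space_restrict_space sets_restrict_space_iff)
  moreover have "?C \<in> sets borel"
    using S_borel by (auto simp: borel_prod[symmetric] intro!: pair_measureI)
  ultimately have B: "?B \<union> ?C \<in> sets borel" by blast
  have "compact {a. (x, a) \<in> ?B \<union> ?C}" for x
  proof (cases "x \<in> S")
    case True
    then have "{a. (x, a) \<in> ?B \<union> ?C} = {a \<in> feasible M x. q_value u (x, a) \<le> bellman_op u x}" by (auto simp: K_iff)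
    then show ?thesis using q_value_sublevel_compact[OF u True] by simp
  next
    case False
    then have "{a. (x, a) \<in> ?B \<union> ?C} = {a0}" by (auto simp: K_iff)
    then show ?thesis by simp
  qed
  moreover have "\<exists>a. (x, a) \<in> ?B \<union> ?C" for x
    using bellman_op_attained[OF u, of x] by (cases "x \<in> S") (auto simp: K_iff)
  ultimately obtain f where f: "f \<in> borel_measurable borel" "\<And>x. (x, f x) \<in> ?B \<union> ?C"
    using borel_selector_of_compact_sections[OF B] by blast
  have "f x \<in> feasible M x \<and> q_value u (x, f x) = bellman_op u x" if "x \<in> S" for x
  proof -
    have "f x \<in> feasible M x" "q_value u (x, f x) \<le> bellman_op u x"
      using f(2)[of x] that by (auto simp: K_iff)
    moreover have "bellman_op u x \<le> q_value u (x, f x)"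
      unfolding bellman_op_def using calculation by (intro INF_lower)
    ultimately show ?thesis by simp
  qed
  with f(1) show ?thesis by blast
qed

end

section \<open>Value iteration\<close>

text \<open>The growth conditions with respect to the weight function.\<close>

locale weighted_control = regular_control M
  for M :: "('x::polish_space, 'a::polish_space, 'm) control_model_scheme" +
  fixes w :: "'x \<Rightarrow> real" and cbar \<beta> \<gamma> :: real
  assumes cbar: "0 < cbar"
    and beta: "1 \<le> \<beta>" "\<beta> < 1 / discount M"
    and w_measurable: "w \<in> borel_measurable (restrict_space borel (non_target M))"
    and w_ge_1: "\<And>x. x \<in> non_target M \<Longrightarrow> 1 \<le> w x"
    and cost_bound: "\<And>x. x \<in> non_target M \<Longrightarrow>
          (SUP a\<in>feasible M x. ereal (cost M (x, a))) \<le> ereal (cbar * w x)"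
    and w_bound: "\<And>x. x \<in> non_target M \<Longrightarrow>
          (SUP a\<in>feasible M x. trans_integral M (\<lambda>y. ereal (w y)) (x, a)) \<le> ereal (\<beta> * w x)"
    and gamma: "\<gamma> = discount M * \<beta>"
begin

lemma gamma_bounds: "0 < \<gamma>" "\<gamma> < 1"
  using discount_bounds beta by (auto simp: gamma field_simps)

abbreviation W :: "'x \<Rightarrow> ennreal" where "W y \<equiv> ennreal (w y)"

lemma W_measurable: "W \<in> borel_measurable NT"
  using w_measurable by measurable

lemma cost_le: "(x, a) \<in> K \<Longrightarrow> cost M (x, a) \<le> cbar * w x"
proof -
  assume K: "(x, a) \<in> K"
  then have "ereal (cost M (x, a)) \<le> (SUP a\<in>feasible M x. ereal (cost M (x, a)))"
    by (intro SUP_upper) (simp add: K_iff)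
  also have "\<dots> \<le> ereal (cbar * w x)" using K by (intro cost_bound) (simp add: K_iff)
  finally show ?thesis by simp
qed

lemma killed_integral_W: "(x, a) \<in> K \<Longrightarrow> killed_integral W (x, a) \<le> ennreal \<beta> * W x"
proof -
  assume K: "(x, a) \<in> K"
  have "enn2ereal (killed_integral W (x, a)) = trans_integral M (\<lambda>y. ereal (w y)) (x, a)"
    using w_ge_1 by (intro trans_integral_eq[symmetric]) (force intro!: enn2ereal_ennreal[symmetric])
  also have "\<dots> \<le> (SUP a\<in>feasible M x. trans_integral M (\<lambda>y. ereal (w y)) (x, a))"
    using K by (intro SUP_upper) (simp add: K_iff)
  also have "\<dots> \<le> ereal (\<beta> * w x)" using K by (intro w_bound) (simp add: K_iff)
  finally have "e2ennreal (enn2ereal (killed_integral W (x, a))) \<le> e2ennreal (ereal (\<beta> * w x))"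
    by (rule e2ennreal_mono)
  then show ?thesis using beta by (simp add: ennreal_mult')
qed

text \<open>The contraction property in additive form, for functions with values in the extended nonnegative
  reals: an error \<open>c * w\<close> becomes at most \<open>\<gamma> * c * w\<close>.\<close>

lemma q_value_shift:
  assumes "\<And>y. y \<in> S \<Longrightarrow> u y \<le> u' y + c * W y" "u' \<in> borel_measurable NT" "(x, a) \<in> K"
  shows "q_value u (x, a) \<le> q_value u' (x, a) + ennreal \<gamma> * c * W x"
proof -
  have "q_value u (x, a) \<le> q_value (\<lambda>y. u' y + c * W y) (x, a)"
    by (rule q_value_mono) (rule assms)
  also have "\<dots> = q_value u' (x, a) + ennreal (discount M) * (c * killed_integral W (x, a))"
    unfolding q_value_def killed_integral_add[OF assms(2) W_measurable assms(3)]
    by (simp add: distrib_left add.assoc)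
  also have "\<dots> \<le> q_value u' (x, a) + ennreal (discount M) * (c * (ennreal \<beta> * W x))"
    by (intro add_left_mono mult_left_mono killed_integral_W assms) auto
  also have "ennreal (discount M) * (c * (ennreal \<beta> * W x)) = ennreal \<gamma> * c * W x"
  proof -
    have "ennreal \<gamma> = ennreal (discount M) * ennreal \<beta>"
      using discount_bounds beta by (simp add: gamma ennreal_mult)
    then show ?thesis by (simp add: ac_simps)
  qed
  finally show ?thesis .
qed

lemma bellman_op_shift:
  assumes "\<And>y. y \<in> S \<Longrightarrow> u y \<le> u' y + c * W y" "u' \<in> borel_measurable NT" "x \<in> S"
  shows "bellman_op u x \<le> bellman_op u' x + ennreal \<gamma> * c * W x"
proof -
  obtain a where a: "a \<in> feasible M x" "q_value u' (x, a) = bellman_op u' x"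
    using bellman_op_attained[OF assms(2,3)] by blast
  have "bellman_op u x \<le> q_value u (x, a)" unfolding bellman_op_def by (intro INF_lower a)
  also have "\<dots> \<le> q_value u' (x, a) + ennreal \<gamma> * c * W x"
    using a assms by (intro q_value_shift) (auto simp: K_iff)
  finally show ?thesis by (simp add: a)
qed

text \<open>The value iteration functions, as extended nonnegative reals.\<close>

primrec viter :: "nat \<Rightarrow> 'x \<Rightarrow> ennreal" where
  "viter 0 = (\<lambda>x. 0)"
| "viter (Suc n) = bellman_op (viter n)"

text \<open>The supremum of the value iteration functions; it turns out to be the value function.\<close>

definition viter_limit :: "'x \<Rightarrow> ennreal" where
  "viter_limit x = (SUP n. viter n x)"

lemma viter_measurable: "viter n \<in> borel_measurable NT"
  by (induction n) (simp_all add: bellman_op_measurable)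

lemma viter_limit_measurable: "viter_limit \<in> borel_measurable NT"
  unfolding viter_limit_def[abs_def] by (intro borel_measurable_SUP viter_measurable) simp

lemma value_iter_eq: "x \<in> S \<Longrightarrow> value_iter M n x = enn2ereal (viter n x)"
proof (induction n arbitrary: x)
  case 0
  then show ?case by (simp add: zero_ennreal.rep_eq)
next
  case (Suc n)
  have eq: "bellman M (value_iter M n) x a = enn2ereal (q_value (viter n) (x, a))" if "a \<in> feasible M x" for a
    using that Suc by (intro bellman_eq cost_nonneg) (auto simp: K_iff)
  obtain a where a: "a \<in> feasible M x" "q_value (viter n) (x, a) = bellman_op (viter n) x"
    using bellman_op_attained[OF viter_measurable Suc.prems] by blast
  show ?case
    unfolding value_iter.simps viter.simps
  proof (rule antisym)
    show "(INF a\<in>feasible M x. bellman M (value_iter M n) x a) \<le> enn2ereal (bellman_op (viter n) x)"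
      using a eq[OF a(1)] by (intro INF_lower2[of a]) auto
    have "bellman_op (viter n) x \<le> q_value (viter n) (x, a)" if "a \<in> feasible M x" for a
      unfolding bellman_op_def using that by (rule INF_lower)
    then show "enn2ereal (bellman_op (viter n) x) \<le> (INF a\<in>feasible M x. bellman M (value_iter M n) x a)"
      by (intro INF_greatest) (simp add: eq less_eq_ennreal.rep_eq[symmetric])
  qed
qed

text \<open>Translation of the optimality equation: since the minimum is attained, \<open>is_minimum\<close> holds for exactly
  one value.\<close>

lemma is_minimum_bellman_op:
  assumes "\<And>y. y \<in> S \<Longrightarrow> \<xi> y = enn2ereal (u y)" "u \<in> borel_measurable NT" "x \<in> S"
  shows "is_minimum (feasible M x) (bellman M \<xi> x) m \<longleftrightarrow> m = enn2ereal (bellman_op u x)"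
proof -
  have eq: "bellman M \<xi> x a = enn2ereal (q_value u (x, a))" if "a \<in> feasible M x" for a
    using that assms by (intro bellman_eq cost_nonneg) (auto simp: K_iff)
  obtain a where a: "a \<in> feasible M x" "q_value u (x, a) = bellman_op u x"
    using bellman_op_attained[OF assms(2,3)] by blast
  have low: "enn2ereal (bellman_op u x) \<le> bellman M \<xi> x a" if "a \<in> feasible M x" for a
    unfolding eq[OF that] less_eq_ennreal.rep_eq[symmetric] bellman_op_def using that by (rule INF_lower)
  have att: "bellman M \<xi> x a = enn2ereal (bellman_op u x)"
    by (simp add: eq[OF a(1)] a(2))
  show ?thesis
  proof
    assume m: "is_minimum (feasible M x) (bellman M \<xi> x) m"
    then obtain s where "s \<in> feasible M x" "bellman M \<xi> x s = m" by (auto simp: is_minimum_def)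
    then have "enn2ereal (bellman_op u x) \<le> m" using low by blast
    moreover have "m \<le> enn2ereal (bellman_op u x)" using m a(1) by (auto simp: is_minimum_def att[symmetric])
    ultimately show "m = enn2ereal (bellman_op u x)" by simp
  next
    assume "m = enn2ereal (bellman_op u x)"
    then show "is_minimum (feasible M x) (bellman M \<xi> x) m"
      unfolding is_minimum_def using a(1) att low by blast
  qed
qed

lemma error_eq:
  assumes "0 \<le> c" "x \<in> S"
  shows "ennreal \<gamma> * ennreal (c * \<gamma> ^ n) * W x = ennreal (\<gamma> * c * w x * \<gamma> ^ n)"
  using gamma_bounds assms w_ge_1[of x] by (simp add: ennreal_mult[symmetric] ac_simps)

text \<open>The bound holds for all \<open>m\<close> and \<open>n\<close>, also for \<open>m > n\<close>; it gives the rate of convergence.\<close>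

lemma viter_le: "x \<in> S \<Longrightarrow> viter m x \<le> viter n x + ennreal (cbar * \<gamma> ^ n / (1 - \<gamma>)) * W x"
proof (induction n arbitrary: m x)
  case 0
  show ?case
    using 0
  proof (induction m arbitrary: x)
    case (Suc m)
    obtain a where a: "a \<in> feasible M x" using feasible_ne[OF S_states[OF Suc.prems]] by blast
    then have K: "(x, a) \<in> K" using Suc.prems by (simp add: K_iff)
    have "viter (Suc m) x \<le> q_value (viter m) (x, a)"
      unfolding viter.simps bellman_op_def by (intro INF_lower a)
    also have "\<dots> \<le> q_value (\<lambda>_. 0) (x, a) + ennreal \<gamma> * ennreal (cbar / (1 - \<gamma>)) * W x"
      using Suc.IH by (intro q_value_shift K) auto
    also have "q_value (\<lambda>_. 0) (x, a) = ennreal (cost M (x, a))"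
      by (simp add: q_value_def killed_integral_def)
    also have "\<dots> + ennreal \<gamma> * ennreal (cbar / (1 - \<gamma>)) * W x
        \<le> ennreal (cbar * w x) + ennreal \<gamma> * ennreal (cbar / (1 - \<gamma>)) * W x"
      by (intro add_right_mono ennreal_leI cost_le K)
    also have "ennreal \<gamma> * ennreal (cbar / (1 - \<gamma>)) * W x = ennreal (\<gamma> * (cbar / (1 - \<gamma>)) * w x)"
      using error_eq[of "cbar / (1 - \<gamma>)" x 0] cbar gamma_bounds Suc.prems by simp
    also have "ennreal (cbar * w x) + \<dots> = ennreal (cbar * w x + \<gamma> * (cbar / (1 - \<gamma>)) * w x)"
      using gamma_bounds cbar w_ge_1[OF Suc.prems]
      by (intro ennreal_plus[symmetric] mult_nonneg_nonneg divide_nonneg_nonneg) auto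
    also have "cbar * w x + \<gamma> * (cbar / (1 - \<gamma>)) * w x = cbar / (1 - \<gamma>) * w x"
      using gamma_bounds by (simp add: field_simps)
    also have "ennreal (cbar / (1 - \<gamma>) * w x) = ennreal (cbar / (1 - \<gamma>)) * W x"
      using gamma_bounds cbar w_ge_1[OF Suc.prems] by (intro ennreal_mult) auto
    finally show ?case by simp
  qed simp
next
  case (Suc n)
  show ?case
  proof (cases m)
    case (Suc m')
    have "viter m x \<le> viter (Suc n) x + ennreal \<gamma> * ennreal (cbar * \<gamma> ^ n / (1 - \<gamma>)) * W x"
      unfolding Suc viter.simps using Suc.IH Suc.prems by (intro bellman_op_shift viter_measurable) auto
    also have "ennreal \<gamma> * ennreal (cbar * \<gamma> ^ n / (1 - \<gamma>)) = ennreal (cbar * \<gamma> ^ Suc n / (1 - \<gamma>))"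
      using gamma_bounds cbar by (simp add: ennreal_mult[symmetric] ac_simps)
    finally show ?thesis .
  qed simp
qed

lemma viter_le_limit: "viter n x \<le> viter_limit x"
  unfolding viter_limit_def by (rule SUP_upper) simp

lemma viter_limit_le: "x \<in> S \<Longrightarrow> viter_limit x \<le> viter n x + ennreal (cbar * \<gamma> ^ n / (1 - \<gamma>)) * W x"
  unfolding viter_limit_def by (intro SUP_least viter_le)

lemma viter_limit_fixed_point:
  assumes x: "x \<in> S"
  shows "bellman_op viter_limit x = viter_limit x"
proof (rule antisym)
  show "bellman_op viter_limit x \<le> viter_limit x"
  proof (rule ennreal_le_of_geometric_error)
    fix n
    have "bellman_op viter_limit x \<le> bellman_op (viter n) x + ennreal \<gamma> * ennreal (cbar / (1 - \<gamma>) * \<gamma> ^ n) * W x"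
      using viter_limit_le[of _ n] by (intro bellman_op_shift viter_measurable x) (simp add: field_simps)
    also have "\<dots> \<le> viter_limit x + ennreal \<gamma> * ennreal (cbar / (1 - \<gamma>) * \<gamma> ^ n) * W x"
      using viter_le_limit[of "Suc n" x] by (intro add_right_mono) simp
    also have "ennreal \<gamma> * ennreal (cbar / (1 - \<gamma>) * \<gamma> ^ n) * W x = ennreal (\<gamma> * (cbar / (1 - \<gamma>)) * w x * \<gamma> ^ n)"
      using cbar gamma_bounds x by (intro error_eq) auto
    finally show "bellman_op viter_limit x \<le> viter_limit x + ennreal (\<gamma> * (cbar / (1 - \<gamma>)) * w x * \<gamma> ^ n)" .
  qed (use gamma_bounds in auto)
  show "viter_limit x \<le> bellman_op viter_limit x"
    unfolding viter_limit_def[of x]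
  proof (rule SUP_least)
    fix n show "viter n x \<le> bellman_op viter_limit x"
      by (cases n) (auto intro!: bellman_op_mono viter_le_limit)
  qed
qed

text \<open>A fixed point \<open>u\<close> with \<open>0 \<le> u \<le> k * w\<close> satisfies \<open>v\<^sub>n \<le> u \<le> v\<^sub>n + k * \<gamma>\<^sup>n * w\<close> for all \<open>n\<close>.\<close>

lemma fixed_point_unique:
  assumes u: "u \<in> borel_measurable NT" "\<And>y. y \<in> S \<Longrightarrow> u y = bellman_op u y"
    and bound: "\<And>y. y \<in> S \<Longrightarrow> u y \<le> ennreal k * W y" and k: "0 \<le> k" and x: "x \<in> S"
  shows "u x = viter_limit x"
proof (rule antisym)
  have "u y \<le> viter n y + ennreal (k * \<gamma> ^ n) * W y" if "y \<in> S" for n y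
    using that
  proof (induction n arbitrary: y)
    case 0
    then show ?case using bound by simp
  next
    case (Suc n)
    have "bellman_op u y \<le> bellman_op (viter n) y + ennreal \<gamma> * ennreal (k * \<gamma> ^ n) * W y"
      by (intro bellman_op_shift viter_measurable Suc)
    then show ?case
      using Suc.prems k gamma_bounds by (simp add: u(2)[symmetric] ennreal_mult[symmetric] ac_simps)
  qed
  then have "u x \<le> viter n x + ennreal (k * \<gamma> ^ n) * W x" for n
    using x by simp
  also have "viter n x + ennreal (k * \<gamma> ^ n) * W x \<le> viter_limit x + ennreal (k * \<gamma> ^ n) * W x" for n
    by (intro add_right_mono viter_le_limit)
  also have "ennreal (k * \<gamma> ^ n) * W x = ennreal (k * w x * \<gamma> ^ n)" for n
    using k gamma_bounds w_ge_1[OF x] by (simp add: ennreal_mult[symmetric] ac_simps)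
  finally have "u x \<le> viter_limit x + ennreal (k * w x * \<gamma> ^ n)" for n .
  then show "u x \<le> viter_limit x"
    by (rule ennreal_le_of_geometric_error) (use gamma_bounds in auto)
  have "viter n y \<le> u y" if "y \<in> S" for n y
    using that
  proof (induction n arbitrary: y)
    case (Suc n)
    have "bellman_op (viter n) y \<le> bellman_op u y" by (intro bellman_op_mono Suc)
    then show ?case using u(2)[OF Suc.prems] by simp
  qed simp
  then have "viter n x \<le> u x" for n using x by blast
  then show "viter_limit x \<le> u x" unfolding viter_limit_def by (intro SUP_least)
qed

end

section \<open>Optimality\<close>

context controlled_process
begin

text \<open>A function of the state outside the target, as a function of the state-action pair.\<close>

definition at_state :: "('x \<Rightarrow> ennreal) \<Rightarrow> 'x \<times> 'a \<Rightarrow> ennreal" where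
  "at_state u p = (if fst p \<in> S then u (fst p) else 0)"

lemma at_state_measurable:
  assumes "u \<in> borel_measurable NT"
  shows "at_state u \<in> borel_measurable (X \<Otimes>\<^sub>M A)"
  unfolding at_state_def[abs_def]
  using measurable_compose[OF measurable_fst extend_by_zero_measurable[OF assms]] .

lemma act_average_at_state: "y \<in> S \<Longrightarrow> act_average t (at_state u) y = u y"
  using prob_space.emeasure_space_1[OF policy_prob(2)[OF S_states]]
  by (simp add: act_average_def at_state_def)

lemma stage_mean_0_at_state: "u \<in> borel_measurable NT \<Longrightarrow> stage_mean 0 (at_state u) = u x"
  using start by (simp add: stage_mean_0 at_state_measurable act_average_at_state)

text \<open>The mean of the one-stage lookahead value splits into the cost of stage \<open>n\<close> and the discounted mean at
  time \<open>n + 1\<close>. Summed over \<open>n\<close>, this links the cost of a policy to the optimality operator.\<close>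

lemma stage_mean_q_value:
  assumes u: "u \<in> borel_measurable NT"
  shows "stage_mean n (\<lambda>p. if p \<in> K then q_value u p else 0) =
    stage_mean n stage_cost + ennreal (discount M) * stage_mean (Suc n) (at_state u)"
proof -
  let ?k = "\<lambda>p. if p \<in> K then killed_integral u p else 0"
  have k: "?k \<in> borel_measurable (X \<Otimes>\<^sub>M A)"
    by (rule measurable_on_K[OF killed_integral_measurable[OF u]])
  have "stage_mean (Suc n) (at_state u) = stage_mean n ?k"
    unfolding stage_mean_Suc[OF at_state_measurable[OF u]] killed_integral_def
    by (simp add: act_average_at_state cong: if_cong)
  moreover have "(\<lambda>p. if p \<in> K then q_value u p else 0) = (\<lambda>p. stage_cost p + ennreal (discount M) * ?k p)"
    by (auto simp: q_value_def stage_cost_def fun_eq_iff)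
  ultimately show ?thesis
    using k by (simp add: stage_mean_add stage_cost_measurable stage_mean_cmult)
qed

lemma q_value_on_K_measurable:
  "u \<in> borel_measurable NT \<Longrightarrow> (\<lambda>p. if p \<in> K then q_value u p else 0) \<in> borel_measurable (X \<Otimes>\<^sub>M A)"
  by (rule measurable_on_K[OF q_value_measurable])

end

context weighted_control
begin

text \<open>Every policy costs at least \<open>v\<^sub>n\<close> during its first \<open>n\<close> stages.\<close>

lemma viter_limit_le_cost:
  assumes \<phi>: "\<phi> \<in> policies M" and x: "x \<in> S"
  shows "enn2ereal (viter_limit x) \<le> expected_cost M \<phi> x"
proof -
  interpret controlled_process M \<phi> x
    by unfold_locales (fact \<phi> x)+
  let ?s = "\<lambda>k. \<Sum>i<k. ennreal (discount M ^ i) * stage_mean i stage_cost"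
  \<comment> \<open>After \<open>k\<close> stages a horizon of \<open>j\<close> stages is left.\<close>
  have "viter (j + k) x \<le> ?s k + ennreal (discount M ^ k) * stage_mean k (at_state (viter j))" for j k
  proof (induction k arbitrary: j)
    case 0
    then show ?case by (simp add: stage_mean_0_at_state viter_measurable)
  next
    case (Suc k)
    have "stage_mean k (at_state (viter (Suc j))) \<le> stage_mean k (\<lambda>p. if p \<in> K then q_value (viter j) p else 0)"
    proof (rule stage_mean_mono)
      fix p assume p: "p \<in> K"
      obtain y a where "p = (y, a)" by (cases p)
      with p show "at_state (viter (Suc j)) p \<le> (if p \<in> K then q_value (viter j) p else 0)"
        by (auto simp: at_state_def K_iff bellman_op_def intro: INF_lower)
    qed (intro at_state_measurable viter_measurable q_value_on_K_measurable)+
    also have "\<dots> = stage_mean k stage_cost + ennreal (discount M) * stage_mean (Suc k) (at_state (viter j))"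
      by (rule stage_mean_q_value[OF viter_measurable])
    finally have *: "stage_mean k (at_state (viter (Suc j))) \<le> \<dots>" .
    have "viter (j + Suc k) x \<le> ?s k + ennreal (discount M ^ k) * stage_mean k (at_state (viter (Suc j)))"
      using Suc[of "Suc j"] by simp
    also have "\<dots> \<le> ?s k + ennreal (discount M ^ k) *
        (stage_mean k stage_cost + ennreal (discount M) * stage_mean (Suc k) (at_state (viter j)))"
      by (intro add_left_mono mult_left_mono *) simp
    also have "\<dots> = ?s (Suc k) + ennreal (discount M ^ Suc k) * stage_mean (Suc k) (at_state (viter j))"
      using discount_bounds by (simp add: distrib_left ennreal_mult ac_simps)
    finally show ?case .
  qed
  from this[of 0] have "viter k x \<le> ?s k" for k
    by (simp add: stage_mean_def at_state_def cong: if_cong)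
  also have "?s k \<le> (\<Sum>i. ennreal (discount M ^ i) * stage_mean i stage_cost)" for k
    by (rule sum_le_suminf) auto
  finally have "viter_limit x \<le> (\<Sum>i. ennreal (discount M ^ i) * stage_mean i stage_cost)"
    unfolding viter_limit_def by (intro SUP_least)
  then show ?thesis
    by (simp add: expected_cost_eq cost_nonneg less_eq_ennreal.rep_eq)
qed

text \<open>The stationary policy that always takes a minimising action of the optimality equation; on target
  states, where the choice is irrelevant, it follows the given measurable selector of the model.\<close>

lemma optimal_policy:
  "\<exists>\<phi>\<in>policies M. \<forall>x\<in>S. expected_cost M \<phi> x \<le> enn2ereal (viter_limit x)"
proof -
  obtain f where f: "f \<in> borel_measurable borel"
    "\<And>x. x \<in> S \<Longrightarrow> f x \<in> feasible M x \<and> q_value viter_limit (x, f x) = bellman_op viter_limit x"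
    using bellman_op_selector[OF viter_limit_measurable] by blast
  obtain f0 where f0: "f0 \<in> X \<rightarrow>\<^sub>M A" "\<And>x. x \<in> states M \<Longrightarrow> (x, f0 x) \<in> feasible_pairs M"
    using model unfolding is_control_model_def by blast
  define g where "g x = (if x \<in> S then f x else f0 x)" for x
  have g_act: "g x \<in> actions M" if "x \<in> states M" for x
    using that f(2)[of x] f0(2)[of x] feasible_sub[of x] by (auto simp: g_def feasible_pairs_def)
  have g: "g \<in> X \<rightarrow>\<^sub>M A"
  proof -
    have "f \<in> X \<rightarrow>\<^sub>M borel"
      unfolding state_space_def by (intro measurable_restrict_space1 f)
    moreover have "f0 \<in> X \<rightarrow>\<^sub>M borel"
      by (rule measurable_compose[OF f0(1)]) (simp add: action_space_def measurable_restrict_space1)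
    ultimately have "g \<in> X \<rightarrow>\<^sub>M borel"
      unfolding g_def[abs_def] using S_X by measurable
    then show ?thesis
      unfolding action_space_def using g_act
      by (intro measurable_restrict_space2) (auto simp: space_X)
  qed
  define \<phi> where "\<phi> t y = return A (g y)" for t :: nat and y
  have \<phi>: "\<phi> \<in> policies M"
    unfolding policies_def
  proof (intro CollectI allI conjI ballI)
    show "\<phi> t \<in> X \<rightarrow>\<^sub>M prob_algebra A" for t
      unfolding \<phi>_def[abs_def] by (rule measurable_compose[OF g measurable_return_prob_space])
    show "emeasure (\<phi> t y) (feasible M y) = 1" if y: "y \<in> S" for t y
    proof -
      have "feasible M y \<in> sets A"
        using model S_states[OF y] borel_sets(2)
        by (auto simp: is_control_model_def action_space_def sets_restrict_space_iff)
      then show ?thesis using f(2)[OF y] y by (simp add: \<phi>_def g_def)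
    qed
  qed
  have "expected_cost M \<phi> x \<le> enn2ereal (viter_limit x)" if x: "x \<in> S" for x
  proof -
    interpret controlled_process M \<phi> x
      by unfold_locales (fact \<phi> x)+
    let ?s = "\<lambda>k. \<Sum>i<k. ennreal (discount M ^ i) * stage_mean i stage_cost"
    let ?b = "\<lambda>p. if p \<in> K then q_value viter_limit p else 0"
    have step: "stage_mean k ?b \<le> stage_mean k (at_state viter_limit)" for k
    proof (rule stage_mean_mono_average)
      fix y assume y: "y \<in> S"
      have "(\<lambda>a. (y, a)) \<in> A \<rightarrow>\<^sub>M X \<Otimes>\<^sub>M A"
        using S_states[OF y] by (intro measurable_Pair1') (simp add: space_X)
      from measurable_compose[OF this q_value_on_K_measurable[OF viter_limit_measurable]]
      have "act_average k ?b y = ?b (y, g y)"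
        unfolding act_average_def \<phi>_def using g_act[OF S_states[OF y]]
        by (intro nn_integral_return) (auto simp: space_A)
      also have "\<dots> = viter_limit y"
        using f(2)[OF y] y by (simp add: g_def K_iff viter_limit_fixed_point)
      finally show "act_average k ?b y \<le> act_average k (at_state viter_limit) y"
        by (simp add: act_average_at_state[OF y])
    qed (intro at_state_measurable viter_limit_measurable q_value_on_K_measurable)+
    have "?s k + ennreal (discount M ^ k) * stage_mean k (at_state viter_limit) \<le> viter_limit x" for k
    proof (induction k)
      case 0
      then show ?case by (simp add: stage_mean_0_at_state viter_limit_measurable)
    next
      case (Suc k)
      have "?s (Suc k) + ennreal (discount M ^ Suc k) * stage_mean (Suc k) (at_state viter_limit)
          = ?s k + ennreal (discount M ^ k) * stage_mean k ?b"
        unfolding stage_mean_q_value[OF viter_limit_measurable]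
        using discount_bounds by (simp add: distrib_left ennreal_mult ac_simps)
      also have "\<dots> \<le> ?s k + ennreal (discount M ^ k) * stage_mean k (at_state viter_limit)"
        by (intro add_left_mono mult_left_mono step) simp
      finally show ?case using Suc by (rule order_trans)
    qed
    moreover have "?s k \<le> ?s k + ennreal (discount M ^ k) * stage_mean k (at_state viter_limit)" for k
      by simp
    ultimately have "?s k \<le> viter_limit x" for k
      using order_trans by blast
    then have "(\<Sum>i. ennreal (discount M ^ i) * stage_mean i stage_cost) \<le> viter_limit x"
      by (intro suminf_le_const) auto
    then show ?thesis
      by (simp add: expected_cost_eq cost_nonneg less_eq_ennreal.rep_eq)
  qed
  with \<phi> show ?thesis by blast
qed

lemma value_function_eq:
  assumes x: "x \<in> S"
  shows "value_function M x = enn2ereal (viter_limit x)"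
proof (rule antisym)
  obtain \<phi> where "\<phi> \<in> policies M" "expected_cost M \<phi> x \<le> enn2ereal (viter_limit x)"
    using optimal_policy x by blast
  then show "value_function M x \<le> enn2ereal (viter_limit x)"
    unfolding value_function_def by (intro INF_lower2[of \<phi>])
  show "enn2ereal (viter_limit x) \<le> value_function M x"
    unfolding value_function_def by (intro INF_greatest viter_limit_le_cost x)
qed

text \<open>All values are finite, so that the remaining claims are inequalities between real numbers.\<close>

lemma real_values:
  assumes x: "x \<in> S"
  obtains r s where "value_function M x = ereal r" "value_iter M n x = ereal s"
    "0 \<le> s" "s \<le> r" "r \<le> s + cbar * \<gamma> ^ n / (1 - \<gamma>) * w x"
proof -
  have fin: "viter m x < top" "viter_limit x < top" for m
  proof -
    have "viter_limit x \<le> ennreal (cbar / (1 - \<gamma>)) * W x"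
      using viter_limit_le[OF x, of 0] by simp
    also have "\<dots> < top" by (simp add: ennreal_mult_less_top)
    finally show "viter_limit x < top" .
    with viter_le_limit[of m x] show "viter m x < top" by (rule le_less_trans)
  qed
  then obtain r s where rs: "viter_limit x = ennreal r" "0 \<le> r" "viter n x = ennreal s" "0 \<le> s"
    by (metis ennreal_cases less_irrefl infinity_ennreal_def)
  have c: "0 \<le> cbar * \<gamma> ^ n / (1 - \<gamma>)" using cbar gamma_bounds by simp
  have "s \<le> r" using viter_le_limit[of n x] rs by simp
  moreover have "ennreal r \<le> ennreal (s + cbar * \<gamma> ^ n / (1 - \<gamma>) * w x)"
  proof -
    have "ennreal r \<le> ennreal s + ennreal (cbar * \<gamma> ^ n / (1 - \<gamma>)) * W x"
      using viter_limit_le[OF x, of n] rs by simp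
    also have "ennreal (cbar * \<gamma> ^ n / (1 - \<gamma>)) * W x = ennreal (cbar * \<gamma> ^ n / (1 - \<gamma>) * w x)"
      using c w_ge_1[OF x] by (intro ennreal_mult[symmetric]) auto
    also have "ennreal s + \<dots> = ennreal (s + cbar * \<gamma> ^ n / (1 - \<gamma>) * w x)"
      using rs c w_ge_1[OF x] by (intro ennreal_plus[symmetric] mult_nonneg_nonneg) auto
    finally show ?thesis .
  qed
  then have "r \<le> s + cbar * \<gamma> ^ n / (1 - \<gamma>) * w x"
    using rs mult_nonneg_nonneg[OF c, of "w x"] w_ge_1[OF x]
    by (subst (asm) ennreal_le_iff) auto
  ultimately show ?thesis
    using rs by (intro that[of r s]) (simp_all add: value_function_eq[OF x] value_iter_eq[OF x])
qed

lemma weighted_norm_le: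
  assumes "\<And>x. x \<in> S \<Longrightarrow> \<exists>r. u x = ereal r \<and> \<bar>r\<bar> \<le> c * w x"
  shows "weighted_norm M w u \<le> ereal c"
  unfolding weighted_norm_def
proof (rule SUP_least)
  fix x assume x: "x \<in> S"
  then obtain r where r: "u x = ereal r" "\<bar>r\<bar> \<le> c * w x" using assms by blast
  then show "\<bar>u x\<bar> / ereal (w x) \<le> ereal c"
    using w_ge_1[OF x] by (simp add: field_simps)
qed

lemma measurable_enn2ereal_cong:
  assumes "u \<in> borel_measurable NT" "\<And>y. y \<in> S \<Longrightarrow> \<xi> y = enn2ereal (u y)"
  shows "\<xi> \<in> borel_measurable NT"
proof -
  have "(\<lambda>y. enn2ereal (u y)) \<in> borel_measurable NT" using assms(1) by measurable
  then show ?thesis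
    using assms(2) by (subst measurable_cong[of _ _ "\<lambda>y. enn2ereal (u y)"]) (simp_all add: space_restrict_space)
qed

lemma norm_value_function: "weighted_norm M w (value_function M) \<le> ereal (cbar / (1 - \<gamma>))"
proof (rule weighted_norm_le)
  fix x assume x: "x \<in> S"
  obtain r s where "value_function M x = ereal r" "value_iter M 0 x = ereal s"
    "0 \<le> s" "s \<le> r" "r \<le> s + cbar * \<gamma> ^ 0 / (1 - \<gamma>) * w x"
    by (rule real_values[OF x])
  then show "\<exists>r. value_function M x = ereal r \<and> \<bar>r\<bar> \<le> cbar / (1 - \<gamma>) * w x"
    by (intro exI[of _ r]) (auto simp: zero_ereal_def)
qed

lemma value_function_solves: "solves_optimality_eq M w (value_function M)"
  unfolding solves_optimality_eq_def
proof (intro conjI ballI)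
  show "0 \<le> value_function M x" if "x \<in> S" for x
    using that by (simp add: value_function_eq)
  show "value_function M \<in> borel_measurable NT"
    by (rule measurable_enn2ereal_cong[OF viter_limit_measurable value_function_eq])
  show "weighted_norm M w (value_function M) < \<infinity>"
    using norm_value_function by (rule le_less_trans) simp
  show "is_minimum (feasible M x) (bellman M (value_function M) x) (value_function M x)" if "x \<in> S" for x
    using that by (subst is_minimum_bellman_op[OF value_function_eq viter_limit_measurable])
      (simp_all add: value_function_eq viter_limit_fixed_point)
qed

lemma solution_unique:
  assumes \<xi>: "solves_optimality_eq M w \<xi>" and x: "x \<in> S"
  shows "\<xi> x = value_function M x"
proof -
  define u where "u y = e2ennreal (\<xi> y)" for y
  have \<xi>u: "\<xi> y = enn2ereal (u y)" if "y \<in> S" for y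
    using \<xi> that by (simp add: u_def solves_optimality_eq_def enn2ereal_e2ennreal)
  have u: "u \<in> borel_measurable NT"
  proof -
    have "\<xi> \<in> borel_measurable NT"
      using \<xi> by (simp add: solves_optimality_eq_def)
    then show ?thesis unfolding u_def[abs_def] by measurable
  qed
  have fixp: "u y = bellman_op u y" if "y \<in> S" for y
  proof -
    have "is_minimum (feasible M y) (bellman M \<xi> y) (\<xi> y)"
      using \<xi> that by (simp add: solves_optimality_eq_def)
    then have "enn2ereal (u y) = enn2ereal (bellman_op u y)"
      using is_minimum_bellman_op[OF \<xi>u u that] \<xi>u[OF that] by simp
    then show ?thesis by (simp add: enn2ereal_inject)
  qed
  have "weighted_norm M w \<xi> < \<infinity>"
    using \<xi> by (simp add: solves_optimality_eq_def)
  then obtain k :: nat where k: "weighted_norm M w \<xi> < ereal (real k)" by (auto simp: less_PInf_Ex_of_nat)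
  have le: "\<bar>\<xi> y\<bar> / ereal (w y) \<le> ereal (real k)" if "y \<in> S" for y
  proof -
    have "\<bar>\<xi> y\<bar> / ereal (w y) \<le> weighted_norm M w \<xi>"
      unfolding weighted_norm_def using that by (rule SUP_upper)
    also have "\<dots> \<le> ereal (real k)" using k by (rule less_imp_le)
    finally show ?thesis .
  qed
  have "u y \<le> ennreal (real k) * W y" if y: "y \<in> S" for y
  proof -
    have "\<bar>\<xi> y\<bar> \<le> ereal (real k) * ereal (w y)"
      using le[OF y] w_ge_1[OF y] by (subst (asm) ereal_divide_le_pos) (auto simp: mult.commute)
    then have "\<xi> y \<le> ereal (real k * w y)"
      using \<xi>u[OF y] by simp
    then have "e2ennreal (\<xi> y) \<le> e2ennreal (ereal (real k * w y))" by (rule e2ennreal_mono)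
    then show ?thesis by (simp add: u_def ennreal_mult')
  qed
  then have "u x = viter_limit x"
    by (intro fixed_point_unique[of u "real k"] u fixp x) auto
  then show ?thesis using x \<xi>u value_function_eq by simp
qed

lemma value_iteration_error:
  "x \<in> S \<Longrightarrow> value_function M x - value_iter M n x \<le> ereal (cbar * w x * (\<gamma> ^ n / (1 - \<gamma>)))"
proof -
  assume x: "x \<in> S"
  obtain r s where "value_function M x = ereal r" "value_iter M n x = ereal s"
    "0 \<le> s" "s \<le> r" "r \<le> s + cbar * \<gamma> ^ n / (1 - \<gamma>) * w x"
    by (rule real_values[OF x])
  then show ?thesis by (simp add: ac_simps)
qed

lemma value_iteration_norm_error:
  "weighted_norm M w (\<lambda>x. value_iter M n x - value_function M x) \<le> ereal (cbar * \<gamma> ^ n / (1 - \<gamma>))"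
proof (rule weighted_norm_le)
  fix x assume x: "x \<in> S"
  obtain r s where "value_function M x = ereal r" "value_iter M n x = ereal s"
    "0 \<le> s" "s \<le> r" "r \<le> s + cbar * \<gamma> ^ n / (1 - \<gamma>) * w x"
    by (rule real_values[OF x])
  then show "\<exists>r. value_iter M n x - value_function M x = ereal r \<and> \<bar>r\<bar> \<le> cbar * \<gamma> ^ n / (1 - \<gamma>) * w x"
    by (intro exI[of _ "s - r"]) auto
qed

end

theorem proposition4p6:
  fixes M :: "('x::polish_space, 'a::polish_space) control_model"
    and w :: "'x \<Rightarrow> real" and cbar \<beta> \<gamma> :: real
  assumes model: "is_control_model M"
    and compact_actions: "\<And>x. x \<in> states M \<Longrightarrow> compact (feasible M x)"
    and cost_lsc: "seq_lsc_on (active_pairs M) (cost M)"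
    and cost_nonneg: "\<And>p. p \<in> active_pairs M \<Longrightarrow> 0 \<le> cost M p"
    and cost_inf_compact: "inf_compact M (cost M)"
    and feller: "strongly_Feller M"
    and cbar: "0 < cbar"
    and beta: "1 \<le> \<beta>" "\<beta> < 1 / discount M"
    and w_measurable: "w \<in> borel_measurable (restrict_space borel (non_target M))"
    and w_ge_1: "\<And>x. x \<in> non_target M \<Longrightarrow> 1 \<le> w x"
    and cost_bound: "\<And>x. x \<in> non_target M \<Longrightarrow>
          (SUP a\<in>feasible M x. ereal (cost M (x, a))) \<le> ereal (cbar * w x)"
    and w_bound: "\<And>x. x \<in> non_target M \<Longrightarrow>
          (SUP a\<in>feasible M x. trans_integral M (\<lambda>y. ereal (w y)) (x, a)) \<le> ereal (\<beta> * w x)"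
    and gamma: "\<gamma> = discount M * \<beta>"
  shows "weighted_norm M w (value_function M) \<le> ereal (cbar / (1 - \<gamma>)) \<and>
     (\<forall>n. value_iter M n \<in> borel_measurable (restrict_space borel (non_target M))) \<and>
     (\<forall>n\<ge>1. \<forall>x\<in>non_target M.
        is_minimum (feasible M x) (bellman M (value_iter M (n - 1)) x) (value_iter M n x)) \<and>
     (\<forall>n\<ge>1. \<forall>x\<in>non_target M.
        value_function M x - value_iter M n x \<le> ereal (cbar * w x * (\<gamma> ^ n / (1 - \<gamma>)))) \<and>
     (\<forall>n. weighted_norm M w (\<lambda>x. value_iter M n x - value_function M x) \<le>
        ereal (cbar * \<gamma> ^ n / (1 - \<gamma>))) \<and>
     solves_optimality_eq M w (value_function M) \<and>
     (\<forall>\<xi>. solves_optimality_eq M w \<xi> \<longrightarrow> (\<forall>x\<in>non_target M. \<xi> x = value_function M x))"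
proof -
  interpret weighted_control M w cbar \<beta> \<gamma>
    by unfold_locales (fact model compact_actions cost_lsc cost_nonneg feller cbar beta w_measurable
        w_ge_1 cost_bound w_bound gamma)+
  have "value_iter M n \<in> borel_measurable (restrict_space borel (non_target M))" for n
    by (rule measurable_enn2ereal_cong[OF viter_measurable value_iter_eq])
  moreover have "is_minimum (feasible M x) (bellman M (value_iter M (n - 1)) x) (value_iter M n x)"
    if n: "1 \<le> n" and x: "x \<in> non_target M" for n x
  proof -
    obtain m where m: "n = Suc m" using n by (cases n) auto
    have "value_iter M n x = enn2ereal (bellman_op (viter m) x)"
      unfolding m value_iter_eq[OF x] by simp
    then show ?thesis
      unfolding m using is_minimum_bellman_op[OF value_iter_eq viter_measurable x] by simp
  qed
  ultimately show ?thesis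
    using norm_value_function value_iteration_error value_iteration_norm_error
      value_function_solves solution_unique
    by (intro conjI allI impI ballI)
qed

end
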